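(* Let $n \ge m\ge 1$ be integers. Let $\Delta_{m,n}$ be the $m\times n$ chessboard complex and $\mathcal{F}(\Delta_{m,n})$ its facet ideal. Then, for integers $t$ in the indicated ranges, the $\mathrm{v}$-number of the $t$-th ordinary power of $\mathcal{F}(\Delta_{m,n})$ is \[ \mathrm{v}(\mathcal{F}(\Delta_{m,n})^{t})= \begin{cases} t-1, & \text{if } m=1 \text{ and } t\ge 1,\\ mt-1, & \text{if } 2\le m<n\le 2m-2 \text{ and } t\ge m,\\ mt-1, & \text{if } n\ge 2m-1 \text{ and } t\ge 2,\\ mt, & \text{if } n=m\ge 2 \text{ and } t\ge m-1. \end{cases} \]
   Context: Let $\mathbb{K}$ be a field and $S=\mathbb{K}[x_{i,j}\mid 1\le i\le m,\ 1\le j\le n]$ the standard graded polynomial ring, $S_d$ its degree $d$ component. The variable $x_{i,j}$ is identified with the square in row $i$ and column $j$ of an $m\times n$ chessboard. Chessboard complex: $\Delta_{m,n}$ is the simplicial complex on the vertex set $V=\{x_{i,j}\mid 1\le i\le m,\ 1\le j\le n\}$ whose faces are the subsets of $V$ with no two squares in the same row or the same column. A facet is a face maximal with respect to inclusion. Facet ideal: for $F\subseteq V$ put $\mathbf{x}_F=\prod_{x\in F}x$. Then $\mathcal{F}(\Delta_{m,n})=(\mathbf{x}_F\mid F \text{ a facet of } \Delta_{m,n})\subseteq S$; explicitly (as $n\ge m$), $\mathcal{F}(\Delta_{m,n})=(x_{1,\ell_1}\cdots x_{m,\ell_m}\mid 1\le \ell_1,\dots,\ell_m\le n \text{ pairwise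 distinct})$. $\mathrm{v}$-number: for a graded ideal $I\subseteq S$, let $\operatorname{Ass}(I)$ be the set of associated primes of $I$ (i.e. of $S/I$). For $\mathfrak{p}\in\operatorname{Ass}(I)$ let $\mathrm{v}_{\mathfrak{p}}(I)=\min\{d\ge 0\mid \text{there exists } f\in S_d \text{ with } (I:f)=\mathfrak{p}\}$, and let $\mathrm{v}(I)=\min\{\mathrm{v}_{\mathfrak{p}}(I)\mid \mathfrak{p}\in\operatorname{Ass}(I)\}$. *)

theory Defs
  imports
    "HOL-Library.Poly_Mapping"
    "HOL-Library.Extended_Nat"
    "HOL-Algebra.Algebra"
begin

(* A monomial is an exponent vector 'v \<Rightarrow>\<^sub>0 nat, a polynomial a finitely supported
   coefficient function on monomials. *)
type_synonym ('v, 'k) mpoly = "('v \<Rightarrow>\<^sub>0 nat) \<Rightarrow>\<^sub>0 'k"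

definition mpoly_ring :: "'v set \<Rightarrow> ('v, 'k::field) mpoly ring" where
  "mpoly_ring V =
    \<lparr>carrier = {p. \<forall>u \<in> Poly_Mapping.keys p. Poly_Mapping.keys u \<subseteq> V},
     monoid.mult = times, monoid.one = 1, ring.zero = 0, ring.add = plus\<rparr>"

definition mvar :: "'v \<Rightarrow> ('v, 'k::field) mpoly" where
  "mvar x = Poly_Mapping.single (Poly_Mapping.single x 1) 1"

definition mon_degree :: "('v \<Rightarrow>\<^sub>0 nat) \<Rightarrow> nat" where
  "mon_degree u = (\<Sum>x \<in> Poly_Mapping.keys u. Poly_Mapping.lookup u x)"

(* As usual for a graded component, 0 belongs to it for every d. *)
definition mpoly_component :: "'v set \<Rightarrow> nat \<Rightarrow> ('v, 'k::field) mpoly set" where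
  "mpoly_component V d =
    {f \<in> carrier (mpoly_ring V). \<forall>u \<in> Poly_Mapping.keys f. mon_degree u = d}"

definition ideal_colon :: "('a, 'b) ring_scheme \<Rightarrow> 'a set \<Rightarrow> 'a \<Rightarrow> 'a set" where
  "ideal_colon R I f = {g \<in> carrier R. g \<otimes>\<^bsub>R\<^esub> f \<in> I}"

(* (I : f) is the annihilator of the class of f in R/I. *)
definition Ass :: "('a, 'b) ring_scheme \<Rightarrow> 'a set \<Rightarrow> 'a set set" where
  "Ass R I = {P. primeideal P R \<and> (\<exists>f \<in> carrier R. ideal_colon R I f = P)}"

(* The minima are infima in enat: an infimum of a nonempty set is attained, and an empty set
   gives \<infinity> (instead of an unspecified natural number). *)
definition v_number_at :: "'v set \<Rightarrow> ('v, 'k::field) mpoly set \<Rightarrow> ('v, 'k) mpoly set \<Rightarrow> enat" where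
  "v_number_at V I P =
    Inf {enat d | d. \<exists>f \<in> mpoly_component V d. ideal_colon (mpoly_ring V) I f = P}"

definition v_number :: "'v set \<Rightarrow> ('v, 'k::field) mpoly set \<Rightarrow> enat" where
  "v_number V I = Inf {v_number_at V I P | P. P \<in> Ass (mpoly_ring V) I}"

definition ideal_pow :: "('a, 'b) ring_scheme \<Rightarrow> 'a set \<Rightarrow> nat \<Rightarrow> 'a set" where
  "ideal_pow R I t = I [^]\<^bsub>ideals_set R\<^esub> t"

definition board :: "nat \<Rightarrow> nat \<Rightarrow> (nat \<times> nat) set" where
  "board m n = {1..m} \<times> {1..n}"

definition chessboard_complex :: "nat \<Rightarrow> nat \<Rightarrow> (nat \<times> nat) set set" where
  "chessboard_complex m n =
    {F. F \<subseteq> board m n \<and>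
        (\<forall>x \<in> F. \<forall>y \<in> F. x \<noteq> y \<longrightarrow> fst x \<noteq> fst y \<and> snd x \<noteq> snd y)}"

definition facets :: "'v set set \<Rightarrow> 'v set set" where
  "facets \<Delta> = {F \<in> \<Delta>. \<forall>G \<in> \<Delta>. F \<subseteq> G \<longrightarrow> G = F}"

definition facet_ideal :: "'v set \<Rightarrow> 'v set set \<Rightarrow> ('v, 'k::field) mpoly set" where
  "facet_ideal V \<Delta> = Idl\<^bsub>mpoly_ring V\<^esub> {\<Prod>x \<in> F. mvar x | F. F \<in> facets \<Delta>}"

end

theory Submission
  imports Defs "HOL-Library.Product_Lexorder"
begin

text \<open>Read the exponent vector of a monomial on the board as an \<open>m \<times> n\<close> matrix of natural numbers.
The generators of the facet ideal are the 0-1 matrices of full matchings of the rows, and by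
Koenig's theorem on edge colourings a matrix is a sum of \<open>t\<close> such matchings iff all its row sums
are \<open>t\<close> and all its column sums are at most \<open>t\<close> (\<open>regular_exponents_Suc\<close>). Hence the \<open>t\<close>-th power \<open>I\<^sup>t\<close> of the
facet ideal is the monomial ideal of these matrices (\<open>ideal_pow_facet_ideal\<close>), all of which have
degree \<open>m t\<close>.

Lower bound. Let \<open>(I\<^sup>t : f) = P\<close> be prime. Since \<open>P\<close> contains \<open>I\<^sup>t\<close>, every generator has a variable in
\<open>P\<close>. If \<open>x\<close> is such a variable, then \<open>x f \<in> I\<^sup>t\<close>, so \<open>f\<close> has degree at least \<open>m t - 1\<close>. In the square case
\<open>n = m \<ge> 2\<close> the column sums of a generator are also equal to \<open>t\<close>. If \<open>f\<close> had degree \<open>m t - 1\<close>, a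
monomial \<open>u\<close> of \<open>f\<close> would have row and column sums \<open>t\<close> after one unit is added at any variable of \<open>P\<close>;
this determines the square of the board where the unit is missing, so \<open>P\<close> would contain only one variable. But some
permutation avoids that square, and the \<open>t\<close>-th power of its monomial lies in \<open>P\<close>, a contradiction.

Upper bound. Suppose that a monomial \<open>w\<close> has first row sum below \<open>t\<close> and that multiplication by any
variable of the first row brings it into \<open>I\<^sup>t\<close>. Then \<open>(I\<^sup>t : w)\<close> is the prime generated by the
first row (\<open>v_number_le_of_first_row\<close>). For \<open>n (t - 1) \<ge> m t - 1\<close>, which covers all cases except
\<open>n = m \<ge> 2\<close>, there is a matrix with row sums \<open>t - 1, t, ..., t\<close> and column sums at most \<open>t - 1\<close>; it has
degree \<open>m t - 1\<close>. For \<open>n = m \<ge> 2\<close> take row sums \<open>t - 1, t + 1, t, ..., t\<close> and column sums \<open>t\<close>, with a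
positive second row: the unit added at \<open>(1, j)\<close> is compensated by dropping one at \<open>(2, j)\<close>. A positive
second row needs \<open>t + 1 \<ge> m\<close>, which is the hypothesis on \<open>t\<close>.\<close>

section \<open>Matchings and matrices with prescribed row and column sums\<close>

text \<open>The proof is Rado's: unless all the sets \<open>A i\<close> are singletons, one of two elements \<open>x\<close>, \<open>y\<close> of
some \<open>A r\<close> can be removed without violating Hall's condition. Otherwise there are violating index
sets \<open>S\<close> for \<open>x\<close> and \<open>T\<close> for \<open>y\<close>, and counting the elements of the union and of the intersection of
the two small unions contradicts Hall's condition for \<open>S \<union> T\<close> together with \<open>r\<close>, and for \<open>S \<inter> T\<close>.\<close>

lemma hall_marriage:
  fixes A :: "'r \<Rightarrow> 'c set"
  assumes "finite R" and "\<And>i. i \<in> R \<Longrightarrow> finite (A i)"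
    and "\<And>S. S \<subseteq> R \<Longrightarrow> card S \<le> card (\<Union>i\<in>S. A i)"
  shows "\<exists>f. inj_on f R \<and> (\<forall>i\<in>R. f i \<in> A i)"
  using assms
proof (induction "\<Sum>i\<in>R. card (A i)" arbitrary: A rule: less_induct)
  case less
  show ?case
  proof (cases "\<forall>i\<in>R. card (A i) = 1")
    case True
    then have "\<forall>i\<in>R. \<exists>x. A i = {x}" by (simp add: card_1_singleton_iff)
    then obtain f where f: "\<And>i. i \<in> R \<Longrightarrow> A i = {f i}" by metis
    have "inj_on f R"
    proof (rule inj_onI, rule ccontr)
      fix i j assume ij: "i \<in> R" "j \<in> R" "f i = f j" "i \<noteq> j"
      then have "(\<Union>k\<in>{i,j}. A k) = {f i}" using f by auto
      then show False using less.prems(3)[of "{i,j}"] ij by simp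
    qed
    then show ?thesis using f by blast
  next
    case False
    then obtain r where r: "r \<in> R" "card (A r) \<noteq> 1" by blast
    have "card (A r) \<noteq> 0" using less.prems(3)[of "{r}"] r by simp
    then have "\<not> card (A r) \<le> Suc 0" using r by auto
    then obtain x y where xy: "x \<in> A r" "y \<in> A r" "x \<noteq> y"
      using card_le_Suc0_iff_eq[OF less.prems(2)[OF r(1)]] by blast
    define B where "B z = A(r := A r - {z})" for z
    \<comment> \<open>Without a choice for \<open>A\<close> there is none after \<open>z\<close> is removed from \<open>A r\<close>; by induction the smaller
       family violates Hall's condition, on an index set that must contain \<open>r\<close>.\<close>
    have bad: "\<exists>S. S \<subseteq> R - {r} \<and> card ((\<Union>i\<in>S. A i) \<union> (A r - {z})) \<le> card S"
      if z: "z \<in> A r" and no: "\<nexists>f. inj_on f R \<and> (\<forall>i\<in>R. f i \<in> A i)" for z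
    proof -
      have lt: "(\<Sum>i\<in>R. card (B z i)) < (\<Sum>i\<in>R. card (A i))"
      proof (rule sum_strict_mono_ex1[OF less.prems(1)])
        show "\<forall>i\<in>R. card (B z i) \<le> card (A i)"
          using less.prems(2) by (auto simp: B_def card_Diff1_le)
        have "card (A r - {z}) < card (A r)"
          using z less.prems(2)[OF r(1)] by (intro card_Diff1_less)
        then show "\<exists>i\<in>R. card (B z i) < card (A i)"
          using r(1) by (intro bexI[of _ r]) (simp_all only: B_def fun_upd_same)
      qed
      have noB: "\<nexists>f. inj_on f R \<and> (\<forall>i\<in>R. f i \<in> B z i)"
        using no by (auto simp: B_def split: if_splits)
      have "\<exists>T. T \<subseteq> R \<and> \<not> card T \<le> card (\<Union>i\<in>T. B z i)"
        using less.hyps[OF lt less.prems(1)] noB less.prems(2) unfolding B_def by fastforce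
      then obtain T where T: "T \<subseteq> R" "card (\<Union>i\<in>T. B z i) < card T" by force
      have rT: "r \<in> T"
      proof (rule ccontr)
        assume "r \<notin> T"
        then have "(\<Union>i\<in>T. B z i) = (\<Union>i\<in>T. A i)" by (auto simp: B_def)
        then show False using T less.prems(3)[OF T(1)] by simp
      qed
      have fT: "finite T" using T(1) less.prems(1) finite_subset by blast
      have "(\<Union>i\<in>T. B z i) = (\<Union>i\<in>T - {r}. A i) \<union> (A r - {z})"
        using rT by (auto simp: B_def split: if_splits)
      then have "card ((\<Union>i\<in>T - {r}. A i) \<union> (A r - {z})) \<le> card (T - {r})"
        using T(2) rT fT by (simp add: card_Diff_singleton)
      then show ?thesis using T(1) by (intro exI[of _ "T - {r}"]) auto
    qed
    show ?thesis
    proof (rule ccontr)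
      assume no: "\<nexists>f. inj_on f R \<and> (\<forall>i\<in>R. f i \<in> A i)"
      obtain S where S: "S \<subseteq> R - {r}" "card ((\<Union>i\<in>S. A i) \<union> (A r - {x})) \<le> card S"
        using bad[OF xy(1) no] by blast
      obtain T where T: "T \<subseteq> R - {r}" "card ((\<Union>i\<in>T. A i) \<union> (A r - {y})) \<le> card T"
        using bad[OF xy(2) no] by blast
      define P where "P = (\<Union>i\<in>S. A i) \<union> (A r - {x})"
      define Q where "Q = (\<Union>i\<in>T. A i) \<union> (A r - {y})"
      have fST: "finite S" "finite T" using S T less.prems(1) by (auto intro: finite_subset)
      have fin: "finite P" "finite Q"
        unfolding P_def Q_def using S(1) T(1) fST less.prems(2) r(1) by (auto intro!: finite_UN_I)
      have "card (insert r (S \<union> T)) \<le> card (\<Union>i\<in>insert r (S \<union> T). A i)"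
        using S T r by (intro less.prems(3)) auto
      also have "(\<Union>i\<in>insert r (S \<union> T). A i) = P \<union> Q"
        using xy by (auto simp: P_def Q_def)
      finally have 1: "card (S \<union> T) + 1 \<le> card (P \<union> Q)"
        using fST S(1) T(1) by (subst (asm) card_insert_disjoint) auto
      have "card (S \<inter> T) \<le> card (\<Union>i\<in>S \<inter> T. A i)"
        using S by (intro less.prems(3)) auto
      also have "\<dots> \<le> card (P \<inter> Q)"
        using fin by (intro card_mono) (auto simp: P_def Q_def)
      finally have 2: "card (S \<inter> T) \<le> card (P \<inter> Q)" .
      have "card P + card Q = card (P \<union> Q) + card (P \<inter> Q)"
        using card_Un_Int[OF fin] .
      moreover have "card S + card T = card (S \<union> T) + card (S \<inter> T)"
        using card_Un_Int[OF fST] .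
      ultimately show False using 1 2 S(2) T(2) unfolding P_def[symmetric] Q_def[symmetric] by linarith
    qed
  qed
qed

text \<open>The units are distributed one at a time: as long as some row still demands a unit,
some column still has capacity.\<close>

lemma transport_le:
  fixes r :: "'r \<Rightarrow> nat" and c :: "'c \<Rightarrow> nat"
  assumes "finite R" and "finite C" and "sum r R \<le> sum c C"
  shows "\<exists>a. (\<forall>i\<in>R. (\<Sum>j\<in>C. a i j) = r i) \<and> (\<forall>j\<in>C. (\<Sum>i\<in>R. a i j) \<le> c j)"
  using assms(3)
proof (induction "sum r R" arbitrary: r c)
  case 0
  then show ?case using assms(1) by (intro exI[of _ "\<lambda>_ _. 0"]) simp
next
  case (Suc N)
  obtain i0 where i0: "i0 \<in> R" "0 < r i0" 
    using Suc.hyps(2) assms(1) by (metis gr0I nat.distinct(1) sum.neutral)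
  obtain j0 where j0: "j0 \<in> C" "0 < c j0"
    using Suc.hyps(2) Suc.prems by (metis gr0I le_zero_eq nat.distinct(1) sum.neutral)
  define r' where "r' = r(i0 := r i0 - 1)"
  define c' where "c' = c(j0 := c j0 - 1)"
  have r: "r i = r' i + of_bool (i = i0)" for i using i0 by (simp add: r'_def)
  have c: "c j = c' j + of_bool (j = j0)" for j using j0 by (simp add: c'_def)
  have sr: "sum r R = sum r' R + 1"
    unfolding r sum.distrib using i0 assms(1) by simp
  have sc: "sum c C = sum c' C + 1"
    unfolding c sum.distrib using j0 assms(2) by simp
  obtain a where a: "\<And>i. i \<in> R \<Longrightarrow> (\<Sum>j\<in>C. a i j) = r' i" "\<And>j. j \<in> C \<Longrightarrow> (\<Sum>i\<in>R. a i j) \<le> c' j"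
    using Suc.hyps(1)[of r' c'] Suc.hyps(2) Suc.prems sr sc by auto
  define b where "b i j = a i j + of_bool (i = i0) * of_bool (j = j0)" for i j
  have "(\<Sum>j\<in>C. b i j) = r i" if "i \<in> R" for i
    unfolding b_def sum.distrib sum_distrib_left[symmetric] using a(1)[OF that] j0 assms(2) by (simp add: r)
  moreover have "(\<Sum>i\<in>R. b i j) \<le> c j" if "j \<in> C" for j
    unfolding b_def sum.distrib sum_distrib_right[symmetric] using a(2)[OF that] i0 assms(1) by (simp add: c)
  ultimately show ?case by blast
qed

lemma transport_eq:
  fixes r :: "'r \<Rightarrow> nat" and c :: "'c \<Rightarrow> nat"
  assumes "finite R" and "finite C" and "sum r R = sum c C"
  shows "\<exists>a. (\<forall>i\<in>R. (\<Sum>j\<in>C. a i j) = r i) \<and> (\<forall>j\<in>C. (\<Sum>i\<in>R. a i j) = c j)"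
proof -
  obtain a where a: "\<forall>i\<in>R. (\<Sum>j\<in>C. a i j) = r i" "\<And>j. j \<in> C \<Longrightarrow> (\<Sum>i\<in>R. a i j) \<le> c j"
    using transport_le[of R C r c] assms by auto
  have "(\<Sum>j\<in>C. \<Sum>i\<in>R. a i j) = sum c C"
    using sum.swap[of a C R] a(1) assms(3) by simp
  then have "\<forall>j\<in>C. (\<Sum>i\<in>R. a i j) = c j"
    using sum_mono_inv[of "\<lambda>j. \<Sum>i\<in>R. a i j" C c] a(2) assms(2) by blast
  then show ?thesis using a(1) by blast
qed

text \<open>Hall's condition follows by double counting: the rows in \<open>S\<close> have total \<open>t * card S\<close>,
all of which lies in the columns that they meet, and each of these has room for only \<open>t\<close>.\<close>

lemma regular_matrix_matching:
  fixes a :: "'r \<Rightarrow> 'c \<Rightarrow> nat"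
  assumes "finite R" and "finite C" and "0 < t"
    and rows: "\<And>i. i \<in> R \<Longrightarrow> (\<Sum>j\<in>C. a i j) = t"
    and cols: "\<And>j. j \<in> C \<Longrightarrow> (\<Sum>i\<in>R. a i j) \<le> t"
  shows "\<exists>f. inj_on f R \<and> (\<forall>i\<in>R. f i \<in> C \<and> 0 < a i (f i))"
proof -
  have "\<exists>f. inj_on f R \<and> (\<forall>i\<in>R. f i \<in> {j\<in>C. 0 < a i j})"
  proof (rule hall_marriage[OF assms(1)])
    fix S assume S: "S \<subseteq> R"
    define N where "N = (\<Union>i\<in>S. {j\<in>C. 0 < a i j})"
    have N: "N \<subseteq> C" by (auto simp: N_def)
    have fS: "finite S" using S assms(1) finite_subset by blast
    have "card S * t = (\<Sum>i\<in>S. \<Sum>j\<in>C. a i j)" using rows S by (simp add: subset_iff)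
    also have "\<dots> = (\<Sum>i\<in>S. \<Sum>j\<in>N. a i j)"
      using N assms(2) by (intro sum.cong sum.mono_neutral_right) (auto simp: N_def)
    also have "\<dots> = (\<Sum>j\<in>N. \<Sum>i\<in>S. a i j)" by (rule sum.swap)
    also have "\<dots> \<le> (\<Sum>j\<in>N. \<Sum>i\<in>R. a i j)"
      using S assms(1) by (intro sum_mono sum_mono2) auto
    also have "\<dots> \<le> (\<Sum>j\<in>N. t)" using cols N by (intro sum_mono) auto
    finally show "card S \<le> card (\<Union>i\<in>S. {j\<in>C. 0 < a i j})"
      using \<open>0 < t\<close> by (simp add: N_def)
  qed (use assms(2) in auto)
  then show ?thesis by auto
qed

text \<open>To peel off a matching and lower the bound on the column sums from \<open>t\<close> to \<open>t - 1\<close>, the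
matching has to use every column whose sum is \<open>t\<close>. The matrix is therefore padded by further rows
to a square matrix with all row and column sums equal to \<open>t\<close>. A matching of the square matrix
covers all columns, and a column that was already full has only zeros in the new rows.\<close>

lemma matching_covering_full_columns:
  fixes a :: "nat \<Rightarrow> 'c \<Rightarrow> nat"
  assumes "finite C" and "m \<le> card C" and "0 < t"
    and rows: "\<And>i. i \<in> {1..m} \<Longrightarrow> (\<Sum>j\<in>C. a i j) = t"
    and cols: "\<And>j. j \<in> C \<Longrightarrow> (\<Sum>i\<in>{1..m}. a i j) \<le> t"
  shows "\<exists>f. inj_on f {1..m} \<and> (\<forall>i\<in>{1..m}. f i \<in> C \<and> 0 < a i (f i)) \<and>
           (\<forall>j\<in>C. (\<Sum>i\<in>{1..m}. a i j) = t \<longrightarrow> j \<in> f ` {1..m})"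
proof -
  define n where "n = card C"
  have split: "{1..n} = {1..m} \<union> {m<..n}" "{1..m} \<inter> {m<..n} = {}"
    using assms(2) by (auto simp: n_def)
  have "(\<Sum>j\<in>C. t - (\<Sum>i\<in>{1..m}. a i j)) = (\<Sum>j\<in>C. t) - (\<Sum>j\<in>C. \<Sum>i\<in>{1..m}. a i j)"
    using cols by (rule sum_subtractf_nat)
  also have "(\<Sum>j\<in>C. \<Sum>i\<in>{1..m}. a i j) = m * t"
    using rows by (subst sum.swap) simp
  finally have "(\<Sum>i\<in>{m<..n}. t) = (\<Sum>j\<in>C. t - (\<Sum>i\<in>{1..m}. a i j))"
    by (simp add: n_def diff_mult_distrib)
  from transport_eq[OF _ \<open>finite C\<close> this]
  obtain b where b: "\<And>i. i \<in> {m<..n} \<Longrightarrow> (\<Sum>j\<in>C. b i j) = t"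
      "\<And>j. j \<in> C \<Longrightarrow> (\<Sum>i\<in>{m<..n}. b i j) = t - (\<Sum>i\<in>{1..m}. a i j)"
    by blast
  define e where "e i = (if i \<le> m then a i else b i)" for i
  have rows': "(\<Sum>j\<in>C. e i j) = t" if "i \<in> {1..n}" for i
    using that rows b(1) by (auto simp: e_def)
  have cols': "(\<Sum>i\<in>{1..n}. e i j) = t" if "j \<in> C" for j
  proof -
    have "(\<Sum>i\<in>{1..n}. e i j) = (\<Sum>i\<in>{1..m}. e i j) + (\<Sum>i\<in>{m<..n}. e i j)"
      unfolding split(1) using split(2) by (intro sum.union_disjoint) auto
    also have "\<dots> = (\<Sum>i\<in>{1..m}. a i j) + (\<Sum>i\<in>{m<..n}. b i j)"
      by (simp add: e_def)
    finally show ?thesis using b(2)[OF that] cols[OF that] by simp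
  qed
  have "\<exists>f. inj_on f {1..n} \<and> (\<forall>i\<in>{1..n}. f i \<in> C \<and> 0 < e i (f i))"
    by (rule regular_matrix_matching[OF _ assms(1,3)]) (use rows' cols' in simp_all)
  then obtain f where f: "inj_on f {1..n}" "\<And>i. i \<in> {1..n} \<Longrightarrow> f i \<in> C \<and> 0 < e i (f i)"
    by blast
  have "f ` {1..n} = C"
    using f by (intro card_subset_eq[OF \<open>finite C\<close>]) (auto simp: card_image n_def)
  have full: "j \<in> f ` {1..m}" if j: "j \<in> C" "(\<Sum>i\<in>{1..m}. a i j) = t" for j
  proof -
    obtain i where i: "i \<in> {1..n}" "j = f i" using \<open>f ` {1..n} = C\<close> j(1) by blast
    have "b k j = 0" if "k \<in> {m<..n}" for k using b(2)[OF j(1)] j(2) that by simp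
    from this[of i] have "i \<le> m" using f(2)[OF i(1)] i by (cases "i \<le> m") (auto simp: e_def)
    then show ?thesis using i by auto
  qed
  have "inj_on f {1..m}" using f(1) split(1) by (auto intro: inj_on_subset)
  moreover have "f i \<in> C \<and> 0 < a i (f i)" if "i \<in> {1..m}" for i
    using f(2)[of i] that assms(2) by (auto simp: e_def n_def)
  ultimately show ?thesis using full by blast
qed

section \<open>Monomial ideals in polynomial rings\<close>

lemma keys_add_nat: "Poly_Mapping.keys (u + w) = Poly_Mapping.keys u \<union> Poly_Mapping.keys w"
  for u w :: "'v \<Rightarrow>\<^sub>0 nat"
  by (auto simp: in_keys_iff lookup_add)

lemma exponent_eq_single_add_iff:
  "(\<exists>w. u = Poly_Mapping.single x 1 + w) \<longleftrightarrow> x \<in> Poly_Mapping.keys u" for u :: "'v \<Rightarrow>\<^sub>0 nat"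
proof
  assume "x \<in> Poly_Mapping.keys u"
  then have "u = Poly_Mapping.single x 1 + (u - Poly_Mapping.single x 1)"
    by (intro poly_mapping_eqI) (auto simp: lookup_add lookup_minus lookup_single in_keys_iff when_def)
  then show "\<exists>w. u = Poly_Mapping.single x 1 + w" by blast
qed (auto simp: keys_add_nat)

lemma mon_degree_eq_sum:
  "finite V \<Longrightarrow> Poly_Mapping.keys u \<subseteq> V \<Longrightarrow> mon_degree u = (\<Sum>x\<in>V. Poly_Mapping.lookup u x)"
  unfolding mon_degree_def by (rule sum.mono_neutral_left) (auto simp: in_keys_iff)

lemma mon_degree_add: "mon_degree (u + w) = mon_degree u + mon_degree w"
  by (simp add: mon_degree_eq_sum[of "Poly_Mapping.keys u \<union> Poly_Mapping.keys w"] keys_add_nat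
      lookup_add sum.distrib)

lemma mon_degree_single [simp]: "mon_degree (Poly_Mapping.single x k) = k"
  by (simp add: mon_degree_def)

lemma mon_degree_eq_0_iff: "mon_degree u = 0 \<longleftrightarrow> u = 0"
  by (auto simp: mon_degree_def in_keys_iff poly_mapping_eq_iff fun_eq_iff)

abbreviation monomial :: "('v \<Rightarrow>\<^sub>0 nat) \<Rightarrow> ('v, 'k::field) mpoly" where
  "monomial u \<equiv> Poly_Mapping.single u 1"

lemma poly_mapping_eq_sum_single:
  "p = (\<Sum>u\<in>Poly_Mapping.keys p. Poly_Mapping.single u (Poly_Mapping.lookup p u))"
proof (rule poly_mapping_eqI)
  fix k
  show "Poly_Mapping.lookup p k =
    Poly_Mapping.lookup (\<Sum>u\<in>Poly_Mapping.keys p. Poly_Mapping.single u (Poly_Mapping.lookup p u)) k"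
    by (simp add: lookup_sum lookup_single when_def in_keys_iff)
qed

lemma keys_monomial_mult:
  fixes u :: "'v \<Rightarrow>\<^sub>0 nat" and p :: "('v, 'k::field) mpoly"
  shows "Poly_Mapping.keys (monomial u * p) = (+) u ` Poly_Mapping.keys p"
proof
  show "Poly_Mapping.keys (monomial u * p) \<subseteq> (+) u ` Poly_Mapping.keys p"
    using keys_mult[of "monomial u :: ('v, 'k) mpoly" p] by auto
  have "Poly_Mapping.lookup (monomial u * p) (u + w) = Poly_Mapping.lookup p w" for w
  proof -
    have "monomial u * p =
        (\<Sum>k\<in>Poly_Mapping.keys p. Poly_Mapping.single (u + k) (Poly_Mapping.lookup p k))"
      by (subst poly_mapping_eq_sum_single[of p]) (simp add: sum_distrib_left mult_single)
    then show ?thesis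
      by (simp add: lookup_sum lookup_single when_def in_keys_iff)
  qed
  then show "(+) u ` Poly_Mapping.keys p \<subseteq> Poly_Mapping.keys (monomial u * p)"
    by (auto simp: in_keys_iff)
qed

lemma keys_minus_mpoly [simp]: "Poly_Mapping.keys (- p) = Poly_Mapping.keys p"
  for p :: "('v, 'k::field) mpoly"
  by (auto simp: in_keys_iff)

lemma mpoly_ring_simps [simp]:
  "monoid.mult (mpoly_ring V) = times" "monoid.one (mpoly_ring V) = 1"
  "ring.zero (mpoly_ring V) = 0" "ring.add (mpoly_ring V) = plus"
  by (simp_all add: mpoly_ring_def)

lemma in_carrier_mpoly_ring_iff:
  "p \<in> carrier (mpoly_ring V) \<longleftrightarrow> (\<forall>u\<in>Poly_Mapping.keys p. Poly_Mapping.keys u \<subseteq> V)"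
  by (simp add: mpoly_ring_def)

lemma cring_mpoly_ring: "cring (mpoly_ring V :: ('v, 'k::field) mpoly ring)"
proof (rule cringI)
  show "abelian_group (mpoly_ring V :: ('v, 'k) mpoly ring)"
  proof (rule abelian_groupI)
    fix p :: "('v, 'k) mpoly" assume "p \<in> carrier (mpoly_ring V)"
    then show "\<exists>q\<in>carrier (mpoly_ring V). q \<oplus>\<^bsub>mpoly_ring V\<^esub> p = \<zero>\<^bsub>mpoly_ring V\<^esub>"
      by (intro bexI[of _ "- p"]) (auto simp: in_carrier_mpoly_ring_iff in_keys_iff)
  next
    fix p q :: "('v, 'k) mpoly"
    assume "p \<in> carrier (mpoly_ring V)" "q \<in> carrier (mpoly_ring V)"
    then show "p \<oplus>\<^bsub>mpoly_ring V\<^esub> q \<in> carrier (mpoly_ring V)"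
      using keys_add[of p q] by (auto simp: in_carrier_mpoly_ring_iff)
  qed (simp_all add: in_carrier_mpoly_ring_iff add_ac)
  show "comm_monoid (mpoly_ring V :: ('v, 'k) mpoly ring)"
  proof (rule comm_monoidI)
    fix p q :: "('v, 'k) mpoly"
    assume "p \<in> carrier (mpoly_ring V)" "q \<in> carrier (mpoly_ring V)"
    then show "p \<otimes>\<^bsub>mpoly_ring V\<^esub> q \<in> carrier (mpoly_ring V)"
      using keys_mult[of p q] by (fastforce simp: in_carrier_mpoly_ring_iff keys_add_nat)
  qed (simp_all add: in_carrier_mpoly_ring_iff mult_ac)
qed (simp add: distrib_right)

text \<open>The ideal generated by the monomials with exponents in \<open>G\<close> (see \<open>Idl_monomials\<close>), described so
that membership is decided monomial by monomial.\<close>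

definition monomial_ideal :: "'v set \<Rightarrow> ('v \<Rightarrow>\<^sub>0 nat) set \<Rightarrow> ('v, 'k::field) mpoly set" where
  "monomial_ideal V G = {p \<in> carrier (mpoly_ring V). \<forall>u\<in>Poly_Mapping.keys p. \<exists>g\<in>G. \<exists>w. u = g + w}"

lemma ideal_monomial_ideal:
  "ideal (monomial_ideal V G :: ('v, 'k::field) mpoly set) (mpoly_ring V)"
proof -
  interpret cring "mpoly_ring V :: ('v, 'k) mpoly ring" by (rule cring_mpoly_ring)
  have mult: "q * p \<in> monomial_ideal V G"
    if "p \<in> monomial_ideal V G" "q \<in> carrier (mpoly_ring V)" for p q :: "('v, 'k) mpoly"
  proof -
    have "q * p \<in> carrier (mpoly_ring V)"
      using that m_closed[of q p] by (simp add: monomial_ideal_def)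
    moreover have "\<exists>g\<in>G. \<exists>w. u = g + w" if u: "u \<in> Poly_Mapping.keys (q * p)" for u
    proof -
      obtain v k where "v \<in> Poly_Mapping.keys q" "k \<in> Poly_Mapping.keys p" "u = v + k"
        using u keys_mult[of q p] by blast
      moreover from this obtain g w where "g \<in> G" "k = g + w"
        using \<open>p \<in> _\<close> by (auto simp: monomial_ideal_def)
      ultimately show ?thesis by (metis add.left_commute)
    qed
    ultimately show ?thesis by (simp add: monomial_ideal_def)
  qed
  show ?thesis
  proof (rule idealI)
    show "ring (mpoly_ring V :: ('v, 'k) mpoly ring)" by (rule ring_axioms)
    show "subgroup (monomial_ideal V G :: ('v, 'k) mpoly set) (add_monoid (mpoly_ring V))"
    proof (rule group.subgroupI[OF a_group])
      fix p :: "('v, 'k) mpoly" assume p: "p \<in> monomial_ideal V G"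
      have "\<ominus>\<^bsub>mpoly_ring V\<^esub> p = - p"
      proof (rule minus_equality)
        show "- p \<oplus>\<^bsub>mpoly_ring V\<^esub> p = \<zero>\<^bsub>mpoly_ring V\<^esub>" by simp
      qed (use p in \<open>auto simp: monomial_ideal_def in_carrier_mpoly_ring_iff in_keys_iff\<close>)
      then show "inv\<^bsub>add_monoid (mpoly_ring V)\<^esub> p \<in> monomial_ideal V G"
        using p unfolding a_inv_def 
        by (auto simp: monomial_ideal_def in_carrier_mpoly_ring_iff in_keys_iff)
    next
      fix p q :: "('v, 'k) mpoly"
      assume "p \<in> monomial_ideal V G" "q \<in> monomial_ideal V G"
      then show "p \<otimes>\<^bsub>add_monoid (mpoly_ring V)\<^esub> q \<in> monomial_ideal V G"
        using keys_add[of p q] by (fastforce simp: monomial_ideal_def in_carrier_mpoly_ring_iff)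
    next
      have "(0 :: ('v, 'k) mpoly) \<in> monomial_ideal V G"
        by (simp add: monomial_ideal_def in_carrier_mpoly_ring_iff)
      then show "(monomial_ideal V G :: ('v, 'k) mpoly set) \<noteq> {}" by blast
    qed (auto simp: monomial_ideal_def)
  qed (use mult in \<open>auto simp: mult.commute\<close>)
qed

lemma monomial_ideal_subset_ideal:
  fixes J :: "('v, 'k::field) mpoly set"
  assumes "ideal J (mpoly_ring V)"
    and "\<And>g w c. g \<in> G \<Longrightarrow> Poly_Mapping.keys (g + w) \<subseteq> V \<Longrightarrow> Poly_Mapping.single (g + w) c \<in> J"
  shows "monomial_ideal V G \<subseteq> J"
proof
  interpret ideal J "mpoly_ring V" by fact
  fix p :: "('v, 'k) mpoly" assume p: "p \<in> monomial_ideal V G"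
  have partial: "(\<Sum>u\<in>U. Poly_Mapping.single u (Poly_Mapping.lookup p u)) \<in> J"
    if "finite U" "U \<subseteq> Poly_Mapping.keys p" for U
    using that
  proof (induction U rule: finite_induct)
    case empty
    then show ?case using additive_subgroup.zero_closed[OF is_additive_subgroup] by simp
  next
    case (insert u U)
    obtain g w where "g \<in> G" "u = g + w" "Poly_Mapping.keys u \<subseteq> V"
      using p insert.prems by (auto simp: monomial_ideal_def in_carrier_mpoly_ring_iff)
    then have "Poly_Mapping.single u (Poly_Mapping.lookup p u) \<in> J" using assms(2) by blast
    from additive_subgroup.a_closed[OF is_additive_subgroup this] insert show ?case by simp
  qed
  have "p = (\<Sum>u\<in>Poly_Mapping.keys p. Poly_Mapping.single u (Poly_Mapping.lookup p u))"
    by (rule poly_mapping_eq_sum_single)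
  also have "\<dots> \<in> J" by (rule partial) simp_all
  finally show "p \<in> J" .
qed

lemma single_in_monomial_ideal:
  assumes "g \<in> G" "Poly_Mapping.keys (g + w) \<subseteq> V"
  shows "Poly_Mapping.single (g + w) c \<in> monomial_ideal V G"
  using assms by (auto simp: monomial_ideal_def in_carrier_mpoly_ring_iff)

lemma monomial_in_monomial_ideal:
  assumes "g \<in> G" "Poly_Mapping.keys g \<subseteq> V"
  shows "monomial g \<in> monomial_ideal V G"
  using single_in_monomial_ideal[of g G 0 V 1] assms by simp

lemma Idl_monomials:
  assumes "\<And>g. g \<in> G \<Longrightarrow> Poly_Mapping.keys g \<subseteq> V"
  shows "Idl\<^bsub>mpoly_ring V\<^esub> ((\<lambda>g. monomial g :: ('v, 'k::field) mpoly) ` G) = monomial_ideal V G"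
proof -
  interpret cring "mpoly_ring V :: ('v, 'k) mpoly ring" by (rule cring_mpoly_ring)
  have sub: "(\<lambda>g. monomial g :: ('v, 'k) mpoly) ` G \<subseteq> carrier (mpoly_ring V)"
    using assms by (auto simp: in_carrier_mpoly_ring_iff)
  interpret J: ideal "Idl\<^bsub>mpoly_ring V\<^esub> ((\<lambda>g. monomial g :: ('v, 'k) mpoly) ` G)" "mpoly_ring V"
    by (rule genideal_ideal[OF sub])
  show ?thesis
  proof
    show "Idl\<^bsub>mpoly_ring V\<^esub> ((\<lambda>g. monomial g :: ('v, 'k) mpoly) ` G) \<subseteq> monomial_ideal V G"
      using assms by (intro genideal_minimal ideal_monomial_ideal) (auto intro: monomial_in_monomial_ideal)
    show "monomial_ideal V G \<subseteq> Idl\<^bsub>mpoly_ring V\<^esub> ((\<lambda>g. monomial g :: ('v, 'k) mpoly) ` G)"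
    proof (rule monomial_ideal_subset_ideal[OF J.ideal_axioms])
      fix g w :: "'v \<Rightarrow>\<^sub>0 nat" and c :: 'k
      assume g: "g \<in> G" and "Poly_Mapping.keys (g + w) \<subseteq> V"
      then have "Poly_Mapping.single w c \<in> carrier (mpoly_ring V)"
        by (auto simp: in_carrier_mpoly_ring_iff keys_add_nat split: if_splits)
      moreover have "monomial g \<in> Idl\<^bsub>mpoly_ring V\<^esub> ((\<lambda>g. monomial g :: ('v, 'k) mpoly) ` G)"
        using genideal_self[OF sub] g by blast
      ultimately have "monomial g * Poly_Mapping.single w c
          \<in> Idl\<^bsub>mpoly_ring V\<^esub> ((\<lambda>g. monomial g :: ('v, 'k) mpoly) ` G)"
        using J.I_r_closed by fastforce
      then show "Poly_Mapping.single (g + w) c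
          \<in> Idl\<^bsub>mpoly_ring V\<^esub> ((\<lambda>g. monomial g :: ('v, 'k) mpoly) ` G)"
        by (simp add: mult_single)
    qed
  qed
qed

lemma ideal_prod_monomial_ideal:
  assumes "\<And>g. g \<in> G \<Longrightarrow> Poly_Mapping.keys g \<subseteq> V"
  shows "ideal_prod (mpoly_ring V) (monomial_ideal V G) (monomial_ideal V H) =
    (monomial_ideal V {g + h | g h. g \<in> G \<and> h \<in> H} :: ('v, 'k::field) mpoly set)"
    (is "?L = monomial_ideal V ?S")
proof
  interpret cring "mpoly_ring V :: ('v, 'k) mpoly ring" by (rule cring_mpoly_ring)
  interpret GH: ideal "monomial_ideal V ?S :: ('v, 'k) mpoly set" "mpoly_ring V"
    by (rule ideal_monomial_ideal)
  show "?L \<subseteq> monomial_ideal V ?S"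
  proof
    fix s assume "s \<in> ?L"
    then show "s \<in> monomial_ideal V ?S"
    proof (induction rule: ideal_prod.induct)
      case (prod p q)
      have "p * q \<in> carrier (mpoly_ring V)"
        using m_closed[of p q] ideal.Icarr[OF ideal_monomial_ideal prod(1)]
          ideal.Icarr[OF ideal_monomial_ideal prod(2)] by simp
      moreover have "\<exists>s\<in>?S. \<exists>w. u = s + w" if u: "u \<in> Poly_Mapping.keys (p * q)" for u
      proof -
        obtain a b where ab: "a \<in> Poly_Mapping.keys p" "b \<in> Poly_Mapping.keys q" "u = a + b"
          using u keys_mult[of p q] by blast
        obtain g v where "g \<in> G" "a = g + v" using ab prod unfolding monomial_ideal_def by blast
        moreover obtain h w where "h \<in> H" "b = h + w" using ab prod unfolding monomial_ideal_def by blast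
        ultimately have "g + h \<in> ?S" and "u = (g + h) + (v + w)"
          using ab(3) by (blast, simp add: add_ac)
        then show ?thesis by (intro bexI exI)
      qed
      ultimately show ?case unfolding monomial_ideal_def mpoly_ring_simps by blast
    next
      case (sum p q)
      then show ?case using additive_subgroup.a_closed[OF GH.is_additive_subgroup, of p q] by simp
    qed
  qed
  show "monomial_ideal V ?S \<subseteq> ?L"
  proof (rule monomial_ideal_subset_ideal)
    show "ideal ?L (mpoly_ring V)"
      by (intro ideal_prod_is_ideal ideal_monomial_ideal)
    fix s w :: "'v \<Rightarrow>\<^sub>0 nat" and c :: 'k
    assume "s \<in> ?S" and k: "Poly_Mapping.keys (s + w) \<subseteq> V"
    then obtain g h where gh: "g \<in> G" "h \<in> H" "s = g + h" by blast
    have "monomial g \<in> (monomial_ideal V G :: ('v, 'k) mpoly set)"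
      using gh assms by (auto intro: monomial_in_monomial_ideal)
    moreover have "Poly_Mapping.single (h + w) c \<in> (monomial_ideal V H :: ('v, 'k) mpoly set)"
      using gh k by (intro single_in_monomial_ideal) (auto simp: keys_add_nat)
    from ideal_prod.prod[OF calculation this, of "mpoly_ring V"]
    have "monomial g * Poly_Mapping.single (h + w) c \<in> ?L" by simp
    then show "Poly_Mapping.single (s + w) c \<in> ?L"
      by (simp add: mult_single gh add_ac)
  qed
qed

text \<open>Modulo the ideal, each of two polynomials may be replaced by the part whose monomials avoid
\<open>W\<close>. The product of these parts again avoids \<open>W\<close>, so it lies in the ideal only if it is zero, and
then one of the parts is zero. The linear order on the variables provides a monomial order,
which shows that polynomials have no zero divisors.\<close>

lemma primeideal_generated_by_variables:
  fixes V :: "'v::linorder set"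
  assumes "W \<subseteq> V"
  shows "primeideal (monomial_ideal V ((\<lambda>x. Poly_Mapping.single x 1) ` W) :: ('v, 'k::field) mpoly set)
    (mpoly_ring V)" (is "primeideal ?P _")
proof (rule primeidealI)
  interpret cring "mpoly_ring V :: ('v, 'k) mpoly ring" by (rule cring_mpoly_ring)
  interpret P: ideal ?P "mpoly_ring V" by (rule ideal_monomial_ideal)
  show "ideal ?P (mpoly_ring V)" by (rule ideal_monomial_ideal)
  show "cring (mpoly_ring V :: ('v, 'k) mpoly ring)" by (rule cring_mpoly_ring)
  have P_iff: "p \<in> ?P \<longleftrightarrow> p \<in> carrier (mpoly_ring V) \<and>
      (\<forall>u\<in>Poly_Mapping.keys p. \<exists>x\<in>W. x \<in> Poly_Mapping.keys u)" for p
    unfolding monomial_ideal_def by (simp add: exponent_eq_single_add_iff[simplified])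
  have "1 \<in> carrier (mpoly_ring V :: ('v, 'k) mpoly ring)" "1 \<notin> ?P"
    using one_closed unfolding P_iff by auto
  then show "carrier (mpoly_ring V) \<noteq> ?P" by blast
  fix p q :: "('v, 'k) mpoly"
  assume p: "p \<in> carrier (mpoly_ring V)" and q: "q \<in> carrier (mpoly_ring V)"
    and pq: "p \<otimes>\<^bsub>mpoly_ring V\<^esub> q \<in> ?P"
  \<comment> \<open>Separate the monomials that avoid \<open>W\<close> (in \<open>r\<close>) from those in the ideal (in \<open>s\<close>).\<close>
  have split: "\<exists>r s. p = r + s \<and> s \<in> ?P \<and> r \<in> carrier (mpoly_ring V) \<and>
      (\<forall>u\<in>Poly_Mapping.keys r. Poly_Mapping.keys u \<inter> W = {})"
    if "p \<in> carrier (mpoly_ring V)" for p :: "('v, 'k) mpoly"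
  proof -
    define U where "U = {u \<in> Poly_Mapping.keys p. Poly_Mapping.keys u \<inter> W = {}}"
    define r where "r = (\<Sum>u\<in>U. Poly_Mapping.single u (Poly_Mapping.lookup p u))"
    have l: "Poly_Mapping.lookup r u = (if u \<in> U then Poly_Mapping.lookup p u else 0)" for u
      by (auto simp: r_def lookup_sum lookup_single when_def U_def)
    have "Poly_Mapping.lookup p u \<noteq> 0" if "u \<in> U" for u
      using that by (auto simp: U_def)
    then have kr: "Poly_Mapping.keys r = U"
      and ks: "Poly_Mapping.keys (p - r) = Poly_Mapping.keys p - U"
      by (auto simp: in_keys_iff lookup_minus l split: if_splits)
    have "p = r + (p - r)" by simp
    moreover have "p - r \<in> ?P" 
      unfolding P_iff in_carrier_mpoly_ring_iff ks using that
      by (auto simp: U_def in_carrier_mpoly_ring_iff)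
    moreover have "r \<in> carrier (mpoly_ring V)"
      unfolding in_carrier_mpoly_ring_iff kr using that
      by (auto simp: U_def in_carrier_mpoly_ring_iff)
    moreover have "\<forall>u\<in>Poly_Mapping.keys r. Poly_Mapping.keys u \<inter> W = {}"
      unfolding kr by (auto simp: U_def)
    ultimately show ?thesis by blast
  qed
  obtain p0 p1 where p01: "p = p0 + p1" "p1 \<in> ?P" "p0 \<in> carrier (mpoly_ring V)"
      "\<forall>u\<in>Poly_Mapping.keys p0. Poly_Mapping.keys u \<inter> W = {}"
    using split[OF p] by blast
  obtain q0 q1 where q01: "q = q0 + q1" "q1 \<in> ?P" "q0 \<in> carrier (mpoly_ring V)"
      "\<forall>u\<in>Poly_Mapping.keys q0. Poly_Mapping.keys u \<inter> W = {}"
    using split[OF q] by blast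
  have "p0 * q1 \<in> ?P" using P.I_l_closed[OF q01(2) p01(3)] by simp
  moreover have "p1 * q \<in> ?P" using P.I_r_closed[OF p01(2) q] by simp
  ultimately have rest: "p0 * q1 + p1 * q \<in> ?P"
    using additive_subgroup.a_closed[OF P.is_additive_subgroup, of "p0 * q1" "p1 * q"] by simp
  then have "- (p0 * q1 + p1 * q) \<in> ?P"
    unfolding P_iff in_carrier_mpoly_ring_iff keys_minus_mpoly .
  then have "p * q + - (p0 * q1 + p1 * q) \<in> ?P"
    using additive_subgroup.a_closed[OF P.is_additive_subgroup pq] by simp
  also have "p * q + - (p0 * q1 + p1 * q) = p0 * q0"
    by (simp add: p01(1) q01(1) algebra_simps)
  finally have "p0 * q0 \<in> ?P" .
  moreover have "Poly_Mapping.keys u \<inter> W = {}" if u: "u \<in> Poly_Mapping.keys (p0 * q0)" for u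
  proof -
    obtain a b where "a \<in> Poly_Mapping.keys p0" "b \<in> Poly_Mapping.keys q0" "u = a + b"
      using u keys_mult[of p0 q0] by blast
    then show ?thesis using p01(4) q01(4) by (auto simp: keys_add_nat)
  qed
  ultimately have "Poly_Mapping.keys (p0 * q0) = {}" unfolding P_iff by blast
  then have "p0 * q0 = 0" by (simp add: poly_mapping_eq_iff fun_eq_iff in_keys_iff set_eq_iff)
  then show "p \<in> ?P \<or> q \<in> ?P" using p01 q01 by auto
qed

lemma primeideal_monomial_variable:
  fixes P :: "('v, 'k::field) mpoly set"
  assumes "primeideal P (mpoly_ring V)" and "monomial u \<in> P"
  shows "\<exists>x\<in>Poly_Mapping.keys u. mvar x \<in> P"
  using assms(2)
proof (induction "mon_degree u" arbitrary: u)
  interpret primeideal P "mpoly_ring V" by fact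
  case 0
  then have "1 \<in> P" by (simp add: mon_degree_eq_0_iff eq_commute[of 0])
  then show ?case using one_imp_carrier I_notcarr by simp
next
  interpret primeideal P "mpoly_ring V" by fact
  case (Suc d)
  then have "u \<noteq> 0" by (auto simp: mon_degree_def)
  then obtain x where x: "x \<in> Poly_Mapping.keys u" by fastforce
  then obtain w where w: "u = Poly_Mapping.single x 1 + w"
    by (metis exponent_eq_single_add_iff)
  have V: "Poly_Mapping.keys u \<subseteq> V"
    using Icarr[OF Suc.prems] by (simp add: in_carrier_mpoly_ring_iff)
  have eq: "monomial u = mvar x * (monomial w :: ('v, 'k) mpoly)" by (simp add: mvar_def w mult_single)
  have "mvar x \<in> carrier (mpoly_ring V :: ('v, 'k) mpoly ring)"
     "monomial w \<in> carrier (mpoly_ring V :: ('v, 'k) mpoly ring)"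
    using V by (auto simp: in_carrier_mpoly_ring_iff mvar_def w keys_add_nat)
  then have "mvar x \<in> P \<or> monomial w \<in> P" using I_prime[of "mvar x" "monomial w"] Suc.prems eq by simp
  moreover have "mon_degree w = d" using Suc.hyps(2) by (simp add: w mon_degree_add)
  ultimately show ?case using x Suc.hyps(1)[of w] by (auto simp: w keys_add_nat)
qed

section \<open>Prime colon ideals and the v-number\<close>

text \<open>The colon ideal contains the ideal itself, so a prime colon ideal contains a variable of
every generator.\<close>

lemma primeideal_mvar_of_colon:
  fixes f :: "('v, 'k::field) mpoly"
  assumes "primeideal P (mpoly_ring V)" and f: "f \<in> carrier (mpoly_ring V)"
    and P: "ideal_colon (mpoly_ring V) (monomial_ideal V G) f = P"
    and g: "g \<in> G" "Poly_Mapping.keys g \<subseteq> V"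
  shows "\<exists>x\<in>Poly_Mapping.keys g. mvar x \<in> P"
proof (rule primeideal_monomial_variable[OF assms(1)])
  interpret I: ideal "monomial_ideal V G :: ('v, 'k) mpoly set" "mpoly_ring V"
    by (rule ideal_monomial_ideal)
  have "(monomial g :: ('v, 'k) mpoly) \<in> monomial_ideal V G"
    using g by (rule monomial_in_monomial_ideal)
  with I.I_r_closed[OF this f] I.Icarr[OF this] show "monomial g \<in> P"
    by (simp add: P[symmetric] ideal_colon_def)
qed

lemma colon_prime_nonzero:
  fixes f :: "('v, 'k::field) mpoly"
  assumes "primeideal P (mpoly_ring V)"
    and P: "ideal_colon (mpoly_ring V) (monomial_ideal V G) f = P"
  shows "Poly_Mapping.keys f \<noteq> {}"
proof
  assume "Poly_Mapping.keys f = {}"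
  then have "f = 0" by simp
  moreover have "(0 :: ('v, 'k) mpoly) \<in> monomial_ideal V G"
    by (simp add: monomial_ideal_def in_carrier_mpoly_ring_iff)
  ultimately have "P = carrier (mpoly_ring V)"
    unfolding P[symmetric] ideal_colon_def by simp
  then show False using primeideal.I_notcarr[OF assms(1)] by simp
qed

text \<open>Multiplication by a variable translates the set of monomials of \<open>f\<close> without cancellation, so
the divisibility condition of the monomial ideal passes to each single monomial of \<open>f\<close>.\<close>

lemma key_completed_by_variable:
  fixes f :: "('v, 'k::field) mpoly"
  assumes "mvar x \<in> ideal_colon (mpoly_ring V) (monomial_ideal V G) f"
    and "u \<in> Poly_Mapping.keys f"
  shows "\<exists>g\<in>G. \<exists>v. Poly_Mapping.single x 1 + u = g + v"
proof -
  have "mvar x * f \<in> monomial_ideal V G" using assms(1) by (simp add: ideal_colon_def)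
  moreover have "Poly_Mapping.single x 1 + u \<in> Poly_Mapping.keys (mvar x * f)"
    unfolding mvar_def keys_monomial_mult using assms(2) by blast
  ultimately show ?thesis unfolding monomial_ideal_def by blast
qed

lemma colon_monomial:
  fixes w :: "'v \<Rightarrow>\<^sub>0 nat"
  assumes "Poly_Mapping.keys w \<subseteq> V"
  shows "ideal_colon (mpoly_ring V) (monomial_ideal V G) (monomial w :: ('v, 'k::field) mpoly) =
    {p \<in> carrier (mpoly_ring V). \<forall>u\<in>Poly_Mapping.keys p. \<exists>g\<in>G. \<exists>v. w + u = g + v}"
proof -
  have "Poly_Mapping.keys (p * monomial w) = (+) w ` Poly_Mapping.keys p" for p :: "('v, 'k) mpoly"
    by (simp add: mult.commute[of p] keys_monomial_mult)
  then show ?thesis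
    using assms by (auto simp: ideal_colon_def monomial_ideal_def in_carrier_mpoly_ring_iff keys_add_nat)
qed

lemma v_number_greatest:
  fixes I :: "('v, 'k::field) mpoly set"
  assumes "\<And>P f d. primeideal P (mpoly_ring V) \<Longrightarrow> f \<in> mpoly_component V d \<Longrightarrow>
    ideal_colon (mpoly_ring V) I f = P \<Longrightarrow> k \<le> d"
  shows "enat k \<le> v_number V I"
  unfolding v_number_def v_number_at_def using assms
  by (auto intro!: Inf_greatest simp: Ass_def)

lemma v_number_le_mon_degree:
  fixes w :: "'v \<Rightarrow>\<^sub>0 nat"
  assumes "Poly_Mapping.keys w \<subseteq> V"
    and "ideal_colon (mpoly_ring V) I (monomial w :: ('v, 'k::field) mpoly) = P"
    and "primeideal P (mpoly_ring V)"
  shows "v_number V I \<le> enat (mon_degree w)"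
proof -
  have "(monomial w :: ('v, 'k) mpoly) \<in> mpoly_component V (mon_degree w)"
    and c: "(monomial w :: ('v, 'k) mpoly) \<in> carrier (mpoly_ring V)"
    using assms(1) by (simp_all add: mpoly_component_def in_carrier_mpoly_ring_iff)
  then have "v_number_at V I P \<le> enat (mon_degree w)"
    unfolding v_number_at_def using assms(2) by (blast intro: Inf_lower)
  moreover have "P \<in> Ass (mpoly_ring V) I"
    unfolding Ass_def using assms c by blast
  then have "v_number V I \<le> v_number_at V I P"
    unfolding v_number_def by (blast intro: Inf_lower)
  ultimately show ?thesis by (rule order_trans[rotated])
qed

section \<open>Powers of the facet ideal of the chessboard complex\<close>

lemma exponent_with_entries:
  assumes "finite V"
  obtains u :: "'v \<Rightarrow>\<^sub>0 nat" where "Poly_Mapping.keys u \<subseteq> V"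
    and "\<And>x. x \<in> V \<Longrightarrow> Poly_Mapping.lookup u x = a x"
proof
  define u where "u = (\<Sum>x\<in>V. Poly_Mapping.single x (a x))"
  have l: "Poly_Mapping.lookup u x = (if x \<in> V then a x else 0)" for x
    using assms by (simp add: u_def lookup_sum lookup_single when_def)
  show "Poly_Mapping.keys u \<subseteq> V" by (auto simp: in_keys_iff l split: if_splits)
  show "Poly_Mapping.lookup u x = a x" if "x \<in> V" for x using that by (simp add: l)
qed

definition row_sum :: "nat \<Rightarrow> (nat \<times> nat \<Rightarrow>\<^sub>0 nat) \<Rightarrow> nat \<Rightarrow> nat" where
  "row_sum n u i = (\<Sum>j\<in>{1..n}. Poly_Mapping.lookup u (i, j))"

definition col_sum :: "nat \<Rightarrow> (nat \<times> nat \<Rightarrow>\<^sub>0 nat) \<Rightarrow> nat \<Rightarrow> nat" where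
  "col_sum m u j = (\<Sum>i\<in>{1..m}. Poly_Mapping.lookup u (i, j))"

lemma row_sum_add [simp]: "row_sum n (u + w) i = row_sum n u i + row_sum n w i"
  by (simp add: row_sum_def lookup_add sum.distrib)

lemma col_sum_add [simp]: "col_sum m (u + w) j = col_sum m u j + col_sum m w j"
  by (simp add: col_sum_def lookup_add sum.distrib)

lemma row_sum_single:
  "k \<in> {1..n} \<Longrightarrow> row_sum n (Poly_Mapping.single (l, k) 1) i = of_bool (i = l)"
  by (auto simp: row_sum_def lookup_single when_def sum.delta)

lemma col_sum_single:
  "l \<in> {1..m} \<Longrightarrow> col_sum m (Poly_Mapping.single (l, k) 1) j = of_bool (j = k)"
  by (auto simp: col_sum_def lookup_single when_def sum.delta)

lemma finite_board: "finite (board m n)"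
  by (simp add: board_def)

lemma mon_degree_eq_row_sums:
  "Poly_Mapping.keys u \<subseteq> board m n \<Longrightarrow> mon_degree u = (\<Sum>i\<in>{1..m}. row_sum n u i)"
  by (subst mon_degree_eq_sum[OF finite_board], assumption)
     (simp add: board_def row_sum_def sum.cartesian_product case_prod_beta)

text \<open>The exponents of degree \<open>m t\<close> that turn out to be the products of \<open>t\<close> generators of the facet
ideal.\<close>

definition regular_exponents :: "nat \<Rightarrow> nat \<Rightarrow> nat \<Rightarrow> (nat \<times> nat \<Rightarrow>\<^sub>0 nat) set" where
  "regular_exponents m n t = {u. Poly_Mapping.keys u \<subseteq> board m n \<and>
     (\<forall>i\<in>{1..m}. row_sum n u i = t) \<and> (\<forall>j\<in>{1..n}. col_sum m u j \<le> t)}"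

lemma mon_degree_regular_exponent: "u \<in> regular_exponents m n t \<Longrightarrow> mon_degree u = m * t"
  by (auto simp: regular_exponents_def mon_degree_eq_row_sums)

text \<open>The multiple \<open>t\<close> serves both for single matchings (\<open>t = 1\<close>) and for the \<open>t\<close>-th power of one
generator, which shows that the power of the ideal has a generator supported on a given
matching.\<close>

lemma matching_exponent:
  assumes "inj_on f {1..m}" and "\<And>i. i \<in> {1..m} \<Longrightarrow> f i \<in> {1..n}"
  obtains u where "u \<in> regular_exponents m n t"
    and "\<And>i j. Poly_Mapping.lookup u (i, j) = (if i \<in> {1..m} \<and> j = f i then t else 0)"
proof -
  obtain u where u: "Poly_Mapping.keys u \<subseteq> board m n"
    "\<And>x. x \<in> board m n \<Longrightarrow> Poly_Mapping.lookup u x = (if snd x = f (fst x) then t else 0)"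
    using exponent_with_entries[OF finite_board, of m n "\<lambda>x. if snd x = f (fst x) then t else 0"]
    by blast
  have l: "Poly_Mapping.lookup u (i, j) = (if i \<in> {1..m} \<and> j = f i then t else 0)" for i j
  proof (cases "(i, j) \<in> board m n")
    case True
    then show ?thesis using u(2)[OF True] by (auto simp: board_def)
  next
    case False
    then have "Poly_Mapping.lookup u (i, j) = 0" using u(1) by (auto simp: in_keys_iff)
    then show ?thesis using False assms(2)[of i] by (auto simp: board_def)
  qed
  have "row_sum n u i = t" if "i \<in> {1..m}" for i
    using that assms(2)[OF that] by (simp add: row_sum_def l sum.delta)
  moreover have "col_sum m u j \<le> t" for j
  proof -
    have "col_sum m u j = (\<Sum>i\<in>{i\<in>{1..m}. f i = j}. t)"
      unfolding col_sum_def by (rule sum.mono_neutral_cong_right) (auto simp: l)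
    also have "\<dots> = card {i\<in>{1..m}. f i = j} * t" by simp
    also have "\<dots> \<le> 1 * t"
    proof (rule mult_right_mono)
      have "\<forall>k\<in>{i\<in>{1..m}. f i = j}. \<forall>l\<in>{i\<in>{1..m}. f i = j}. k = l"
        using inj_onD[OF assms(1)] by simp
      then show "card {i\<in>{1..m}. f i = j} \<le> 1"
        by (simp add: card_le_Suc0_iff_eq)
    qed simp
    finally show ?thesis by simp
  qed
  ultimately have "u \<in> regular_exponents m n t" using u(1) by (simp add: regular_exponents_def)
  then show ?thesis by (rule that) (rule l)
qed

lemma regular_exponents_0: "regular_exponents m n 0 = {0}"
proof -
  have "u = 0" if "u \<in> regular_exponents m n 0" for u
    using mon_degree_regular_exponent[OF that] by (simp add: mon_degree_eq_0_iff)
  moreover have "0 \<in> regular_exponents m n 0"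
    by (simp add: regular_exponents_def row_sum_def col_sum_def)
  ultimately show ?thesis by blast
qed

text \<open>This is the combinatorial core: subtracting a matching that covers every column of
sum \<open>t + 1\<close> leaves row sums \<open>t\<close> and column sums at most \<open>t\<close>.\<close>

lemma regular_exponents_Suc:
  assumes "m \<le> n"
  shows "regular_exponents m n (Suc t) =
    {g + h | g h. g \<in> regular_exponents m n t \<and> h \<in> regular_exponents m n 1}"
proof
  show "{g + h | g h. g \<in> regular_exponents m n t \<and> h \<in> regular_exponents m n 1}
      \<subseteq> regular_exponents m n (Suc t)"
    by (fastforce simp: regular_exponents_def keys_add_nat)
  show "regular_exponents m n (Suc t) \<subseteq>
      {g + h | g h. g \<in> regular_exponents m n t \<and> h \<in> regular_exponents m n 1}"
  proof
    fix u assume u: "u \<in> regular_exponents m n (Suc t)"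
    have "\<exists>f. inj_on f {1..m} \<and> (\<forall>i\<in>{1..m}. f i \<in> {1..n} \<and> 0 < Poly_Mapping.lookup u (i, f i)) \<and>
        (\<forall>j\<in>{1..n}. (\<Sum>i\<in>{1..m}. Poly_Mapping.lookup u (i, j)) = Suc t \<longrightarrow> j \<in> f ` {1..m})"
      by (rule matching_covering_full_columns)
         (use u assms in \<open>simp_all add: regular_exponents_def row_sum_def col_sum_def\<close>)
    then obtain f where f: "inj_on f {1..m}"
        "\<And>i. i \<in> {1..m} \<Longrightarrow> f i \<in> {1..n}" "\<And>i. i \<in> {1..m} \<Longrightarrow> 0 < Poly_Mapping.lookup u (i, f i)"
        "\<And>j. j \<in> {1..n} \<Longrightarrow> col_sum m u j = Suc t \<Longrightarrow> j \<in> f ` {1..m}"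
      unfolding col_sum_def by blast
    obtain h where h: "h \<in> regular_exponents m n 1"
        "\<And>i j. Poly_Mapping.lookup h (i, j) = (if i \<in> {1..m} \<and> j = f i then 1 else 0)"
      using matching_exponent[OF f(1,2)] by blast
    define g where "g = u - h"
    have ugh: "u = g + h"
    proof (rule poly_mapping_eqI)
      fix x :: "nat \<times> nat"
      show "Poly_Mapping.lookup u x = Poly_Mapping.lookup (g + h) x"
        using f(3)[of "fst x"] by (cases x) (auto simp: g_def lookup_add lookup_minus h(2))
    qed
    have "g \<in> regular_exponents m n t"
    proof -
      have "Poly_Mapping.keys g \<subseteq> board m n"
        using u by (auto simp: regular_exponents_def ugh keys_add_nat)
      moreover have "row_sum n g i = t" if "i \<in> {1..m}" for i
      proof -
        have "row_sum n g i + row_sum n h i = Suc t" "row_sum n h i = 1"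
          using u h(1) that by (simp_all add: regular_exponents_def ugh)
        then show ?thesis by simp
      qed
      moreover have "col_sum m g j \<le> t" if j: "j \<in> {1..n}" for j
      proof -
        have le: "col_sum m g j + col_sum m h j \<le> Suc t"
          using u j by (simp add: regular_exponents_def ugh)
        show ?thesis
        proof (cases "col_sum m u j = Suc t")
          case True
          then obtain i where "i \<in> {1..m}" "j = f i" using f(4)[OF j] by blast
          then have "Poly_Mapping.lookup h (i, j) \<le> col_sum m h j"
            unfolding col_sum_def by (intro member_le_sum) auto
          then show ?thesis using le \<open>i \<in> _\<close> \<open>j = f i\<close> by (simp add: h(2))
        next
          case False
          then show ?thesis using le by (simp add: ugh)
        qed
      qed
      ultimately show ?thesis by (simp add: regular_exponents_def)
    qed
    then show "u \<in> {g + h | g h. g \<in> regular_exponents m n t \<and> h \<in> regular_exponents m n 1}"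
      using ugh h(1) by blast
  qed
qed

lemma lookup_sum_single_1:
  "finite F \<Longrightarrow> Poly_Mapping.lookup (\<Sum>x\<in>F. Poly_Mapping.single x (1::nat)) y = of_bool (y \<in> F)"
  by (simp add: lookup_sum lookup_single when_def)

text \<open>Were a row empty, fewer than \<open>m \<le> n\<close> squares would be occupied, so some column would be
empty too and the face could be enlarged.\<close>

lemma facet_meets_every_row:
  assumes "m \<le> n" and F: "F \<in> facets (chessboard_complex m n)" and "i \<in> {1..m}"
  shows "\<exists>j\<in>{1..n}. (i, j) \<in> F"
proof (rule ccontr)
  assume no: "\<not> (\<exists>j\<in>{1..n}. (i, j) \<in> F)"
  have rook: "F \<subseteq> board m n" "\<And>x y. x \<in> F \<Longrightarrow> y \<in> F \<Longrightarrow> x \<noteq> y \<Longrightarrow> fst x \<noteq> fst y \<and> snd x \<noteq> snd y"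
    and max: "\<And>G. G \<in> chessboard_complex m n \<Longrightarrow> F \<subseteq> G \<Longrightarrow> G = F"
    using F unfolding facets_def chessboard_complex_def by blast+
  have fin: "finite F" using rook(1) finite_board finite_subset by blast
  have "inj_on fst F" "inj_on snd F" using rook(2) by (meson inj_onI)+
  have "fst ` F \<subseteq> {1..m} - {i}" using rook(1) no by (fastforce simp: board_def)
  then have "card (fst ` F) \<le> card ({1..m} - {i})" by (intro card_mono) auto
  then have "card F < n"
    using \<open>inj_on fst F\<close> assms(1,3) by (auto simp: card_image)
  then have "card (snd ` F) < card {1..n}"
    using \<open>inj_on snd F\<close> by (simp add: card_image)
  then have "\<not> {1..n} \<subseteq> snd ` F" using fin card_mono by (metis finite_imageI not_le)
  then obtain j where j: "j \<in> {1..n}" "j \<notin> snd ` F" by blast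
  have "fst x \<noteq> i \<and> snd x \<noteq> j" if "x \<in> F" for x
    using that no rook(1) j(2) by (cases x) (auto simp: board_def image_iff)
  moreover have "(i, j) \<in> board m n" using j(1) assms(3) by (simp add: board_def)
  ultimately have "insert (i, j) F \<in> chessboard_complex m n"
    unfolding chessboard_complex_def using rook by auto
  from max[OF this] have "(i, j) \<in> F" by blast
  then show False using no j by blast
qed

lemma facet_exponents:
  assumes "m \<le> n"
  shows "{\<Sum>x\<in>F. Poly_Mapping.single x 1 | F. F \<in> facets (chessboard_complex m n)} =
    regular_exponents m n 1"
proof (intro equalityI subsetI)
  fix u :: "nat \<times> nat \<Rightarrow>\<^sub>0 nat"
  assume "u \<in> {\<Sum>x\<in>F. Poly_Mapping.single x 1 | F. F \<in> facets (chessboard_complex m n)}"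
  then obtain F where F: "F \<in> facets (chessboard_complex m n)"
    and u: "u = (\<Sum>x\<in>F. Poly_Mapping.single x 1)" by blast
  have rook: "F \<subseteq> board m n" "\<And>x y. x \<in> F \<Longrightarrow> y \<in> F \<Longrightarrow> x \<noteq> y \<Longrightarrow> fst x \<noteq> fst y \<and> snd x \<noteq> snd y"
    using F unfolding facets_def chessboard_complex_def by blast+
  have fin: "finite F" using rook(1) finite_board finite_subset by blast
  have "\<forall>i\<in>{1..m}. \<exists>j. j \<in> {1..n} \<and> (i, j) \<in> F"
    using facet_meets_every_row[OF assms F] by blast
  from bchoice[OF this] obtain f where f: "\<And>i. i \<in> {1..m} \<Longrightarrow> f i \<in> {1..n} \<and> (i, f i) \<in> F"
    by blast
  have inj: "inj_on f {1..m}"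
  proof (rule inj_onI, rule ccontr)
    fix i k assume "i \<in> {1..m}" "k \<in> {1..m}" "f i = f k" "i \<noteq> k"
    then show False using rook(2)[of "(i, f i)" "(k, f k)"] f[of i] f[of k] by simp
  qed
  obtain w where w: "w \<in> regular_exponents m n 1"
      "\<And>i j. Poly_Mapping.lookup w (i, j) = (if i \<in> {1..m} \<and> j = f i then 1 else 0)"
    using matching_exponent[OF inj] f by blast
  have "u = w"
  proof (rule poly_mapping_eqI)
    fix x :: "nat \<times> nat"
    obtain i j where x: "x = (i, j)" by (cases x)
    have "(i, j) \<in> F \<longleftrightarrow> i \<in> {1..m} \<and> j = f i"
    proof
      assume ij: "(i, j) \<in> F"
      then have "i \<in> {1..m}" using rook(1) by (auto simp: board_def)
      then show "i \<in> {1..m} \<and> j = f i" using f[of i] rook(2)[OF ij, of "(i, f i)"] by auto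
    qed (use f in auto)
    then show "Poly_Mapping.lookup u x = Poly_Mapping.lookup w x"
      unfolding u x lookup_sum_single_1[OF fin] w(2) by simp
  qed
  then show "u \<in> regular_exponents m n 1" using w(1) by simp
next
  fix u assume u: "u \<in> regular_exponents m n 1"
  define F where "F = Poly_Mapping.keys u"
  have row: "row_sum n u i = 1" if "i \<in> {1..m}" for i
    using u that by (simp add: regular_exponents_def)
  have col: "col_sum m u j \<le> 1" if "j \<in> {1..n}" for j
    using u that by (simp add: regular_exponents_def)
  have board: "F \<subseteq> board m n" using u by (auto simp: regular_exponents_def F_def)
  have row_le: "(\<Sum>j\<in>J. Poly_Mapping.lookup u (i, j)) \<le> 1" if "i \<in> {1..m}" "J \<subseteq> {1..n}" for i J
    using row[OF that(1)] sum_mono2[OF _ that(2), of "\<lambda>j. Poly_Mapping.lookup u (i, j)"]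
    by (simp add: row_sum_def)
  have col_le: "(\<Sum>i\<in>J. Poly_Mapping.lookup u (i, j)) \<le> 1" if "j \<in> {1..n}" "J \<subseteq> {1..m}" for j J
    using col[OF that(1)] sum_mono2[OF _ that(2), of "\<lambda>i. Poly_Mapping.lookup u (i, j)"]
    by (simp add: col_sum_def)
  have entry: "i \<in> {1..m}" "j \<in> {1..n}" "1 \<le> Poly_Mapping.lookup u (i, j)"
    if "(i, j) \<in> F" for i j
  proof -
    have "(i, j) \<in> board m n" using that board by (rule subsetD[rotated])
    then show "i \<in> {1..m}" "j \<in> {1..n}" by (simp_all add: board_def)
    show "1 \<le> Poly_Mapping.lookup u (i, j)"
      using that unfolding F_def in_keys_iff by simp
  qed
  have same_row: "j = k" if "(i, j) \<in> F" "(i, k) \<in> F" for i j k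
  proof (rule ccontr)
    assume "j \<noteq> k"
    then show False
      using row_le[of i "{j, k}"] entry[OF that(1)] entry[OF that(2)] by simp
  qed
  have same_col: "i = k" if "(i, j) \<in> F" "(k, j) \<in> F" for i j k
  proof (rule ccontr)
    assume "i \<noteq> k"
    then show False
      using col_le[of j "{i, k}"] entry[OF that(1)] entry[OF that(2)] by simp
  qed
  have "fst x \<noteq> fst y \<and> snd x \<noteq> snd y" if "x \<in> F" "y \<in> F" "x \<noteq> y" for x y
    using that same_row[of "fst x" "snd x" "snd y"] same_col[of "fst x" "snd x" "fst y"]
    by (cases x; cases y) auto
  then have complex: "F \<in> chessboard_complex m n"
    unfolding chessboard_complex_def using board by simp
  have "G = F" if G: "G \<in> chessboard_complex m n" "F \<subseteq> G" for G
  proof (rule antisym[OF _ G(2)], rule subrelI)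
    fix i j assume ij: "(i, j) \<in> G"
    then have "i \<in> {1..m}" using G(1) by (auto simp: chessboard_complex_def board_def)
    then have "(\<Sum>j\<in>{1..n}. Poly_Mapping.lookup u (i, j)) \<noteq> 0"
      using row by (simp add: row_sum_def)
    then have "\<exists>k\<in>{1..n}. Poly_Mapping.lookup u (i, k) \<noteq> 0"
      by (simp add: sum_eq_0_iff)
    then obtain k where k: "(i, k) \<in> F"
      unfolding F_def in_keys_iff by blast
    have "\<not> (i, j) \<noteq> (i, k)"
    proof
      assume "(i, j) \<noteq> (i, k)"
      then have "fst (i, j) \<noteq> fst (i, k)"
        using G ij k unfolding chessboard_complex_def by blast
      then show False by simp
    qed
    with k show "(i, j) \<in> F" by simp
  qed
  then have "F \<in> facets (chessboard_complex m n)"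
    using complex by (simp add: facets_def)
  moreover have "u = (\<Sum>x\<in>F. Poly_Mapping.single x 1)"
  proof (rule poly_mapping_eqI)
    fix x :: "nat \<times> nat"
    obtain i j where x: "x = (i, j)" by (cases x)
    have "Poly_Mapping.lookup u x = of_bool (x \<in> F)"
    proof (cases "x \<in> F")
      case True
      then show ?thesis using entry[of i j] row_le[of i "{j}"] by (simp add: x)
    next
      case False
      then show ?thesis by (simp add: F_def in_keys_iff)
    qed
    then show "Poly_Mapping.lookup u x = Poly_Mapping.lookup (\<Sum>x\<in>F. Poly_Mapping.single x 1) x"
      unfolding F_def lookup_sum_single_1[OF finite_keys] .
  qed
  ultimately show "u \<in> {\<Sum>x\<in>F. Poly_Mapping.single x 1 | F. F \<in> facets (chessboard_complex m n)}"
    by (intro CollectI exI conjI)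
qed

lemma prod_mvar_eq_monomial:
  "finite F \<Longrightarrow> (\<Prod>x\<in>F. mvar x) = (monomial (\<Sum>x\<in>F. Poly_Mapping.single x 1) :: ('v, 'k::field) mpoly)"
  by (induction F rule: finite_induct) (simp_all add: mvar_def mult_single)

lemma facet_ideal_eq_monomial_ideal:
  assumes "m \<le> n"
  shows "facet_ideal (board m n) (chessboard_complex m n) =
    (monomial_ideal (board m n) (regular_exponents m n 1) :: (nat \<times> nat, 'k::field) mpoly set)"
proof -
  have fin: "finite F" if "F \<in> facets (chessboard_complex m n)" for F
    using that finite_board[of m n] finite_subset by (auto simp: facets_def chessboard_complex_def)
  have "{\<Prod>x\<in>F. mvar x :: (nat \<times> nat, 'k) mpoly | F. F \<in> facets (chessboard_complex m n)} =
    (\<lambda>F. \<Prod>x\<in>F. mvar x) ` facets (chessboard_complex m n)" by blast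
  also have "\<dots> = (\<lambda>F. monomial (\<Sum>x\<in>F. Poly_Mapping.single x 1)) ` facets (chessboard_complex m n)"
    by (intro image_cong refl prod_mvar_eq_monomial fin)
  also have "\<dots> = monomial ` {\<Sum>x\<in>F. Poly_Mapping.single x 1 | F. F \<in> facets (chessboard_complex m n)}"
    by blast
  also have "\<dots> = monomial ` regular_exponents m n 1"
    by (simp only: facet_exponents[OF assms])
  finally show ?thesis
    unfolding facet_ideal_def by (simp only:) (rule Idl_monomials, simp add: regular_exponents_def)
qed

lemma ideal_pow_facet_ideal:
  assumes "m \<le> n"
  shows "ideal_pow (mpoly_ring (board m n)) (facet_ideal (board m n) (chessboard_complex m n)) t =
    (monomial_ideal (board m n) (regular_exponents m n t) :: (nat \<times> nat, 'k::field) mpoly set)"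
proof (induction t)
  case 0
  show ?case
    by (auto simp: ideal_pow_def nat_pow_def ideals_set_def regular_exponents_0 monomial_ideal_def)
next
  case (Suc t)
  let ?I = "facet_ideal (board m n) (chessboard_complex m n) :: (nat \<times> nat, 'k) mpoly set"
  have "ideal_pow (mpoly_ring (board m n)) ?I (Suc t) =
      ideal_prod (mpoly_ring (board m n)) (ideal_pow (mpoly_ring (board m n)) ?I t) ?I"
    by (simp add: ideal_pow_def nat_pow_def ideals_set_def)
  also have "\<dots> = monomial_ideal (board m n) (regular_exponents m n (Suc t))"
    unfolding Suc.IH unfolding facet_ideal_eq_monomial_ideal[OF assms] regular_exponents_Suc[OF assms, of t]
    by (rule ideal_prod_monomial_ideal) (simp add: regular_exponents_def)
  finally show ?case .
qed

section \<open>Lower bounds for the v-number\<close>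

lemma mon_degree_lower_bound:
  fixes P :: "(nat \<times> nat, 'k::field) mpoly set"
  assumes "m \<le> n" and "primeideal P (mpoly_ring (board m n))"
    and "f \<in> mpoly_component (board m n) d"
    and P: "ideal_colon (mpoly_ring (board m n)) (monomial_ideal (board m n) (regular_exponents m n t)) f = P"
  shows "m * t - 1 \<le> d"
proof -
  obtain u where u: "u \<in> Poly_Mapping.keys f"
    using colon_prime_nonzero[OF assms(2) P] by blast
  have f: "f \<in> carrier (mpoly_ring (board m n))" and d: "mon_degree u = d"
    using assms(3) u by (auto simp: mpoly_component_def)
  have "inj_on (\<lambda>i. i) {1..m}" and "\<And>i. i \<in> {1..m} \<Longrightarrow> i \<in> {1..n}"
    using assms(1) by simp_all
  then obtain g where g: "g \<in> regular_exponents m n t"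
    by (rule matching_exponent)
  then have "Poly_Mapping.keys g \<subseteq> board m n" by (simp add: regular_exponents_def)
  from primeideal_mvar_of_colon[OF assms(2) f P g this] obtain x where "mvar x \<in> P" by blast
  then obtain g v where gv: "g \<in> regular_exponents m n t" "Poly_Mapping.single x 1 + u = g + v"
    using key_completed_by_variable[OF _ u] P by blast
  have "1 + d = m * t + mon_degree v"
    using arg_cong[OF gv(2), of mon_degree] by (simp add: mon_degree_add d mon_degree_regular_exponent[OF gv(1)])
  then show ?thesis by linarith
qed

lemma square_col_sums:
  assumes "u \<in> regular_exponents m m t" and "j \<in> {1..m}"
  shows "col_sum m u j = t"
proof -
  have "(\<Sum>j\<in>{1..m}. col_sum m u j) = (\<Sum>i\<in>{1..m}. row_sum m u i)"
    unfolding col_sum_def row_sum_def by (rule sum.swap)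
  also have "\<dots> = (\<Sum>j\<in>{1..m}. t)" using assms(1) by (simp add: regular_exponents_def)
  finally show ?thesis
    using sum_mono_inv[of "col_sum m u" "{1..m}" "\<lambda>_. t" j] assms
    by (simp add: regular_exponents_def)
qed

text \<open>If \<open>d\<close> were \<open>m t - 1\<close>, each variable of \<open>P\<close> would complete a monomial of \<open>f\<close> to constant row and
column sums. Only one square can do this, but \<open>P\<close> contains at least two variables: every
permutation passes through a square of \<open>P\<close>, and for \<open>m \<ge> 2\<close> each square is avoided by some
permutation.\<close>

lemma mon_degree_lower_bound_square:
  fixes P :: "(nat \<times> nat, 'k::field) mpoly set"
  assumes "2 \<le> m" and "primeideal P (mpoly_ring (board m m))"
    and "f \<in> mpoly_component (board m m) d"
    and P: "ideal_colon (mpoly_ring (board m m)) (monomial_ideal (board m m) (regular_exponents m m t)) f = P"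
  shows "m * t \<le> d"
proof (rule ccontr)
  assume "\<not> m * t \<le> d"
  then have lt: "d < m * t" by simp
  obtain u where u: "u \<in> Poly_Mapping.keys f"
    using colon_prime_nonzero[OF assms(2) P] by blast
  have f: "f \<in> carrier (mpoly_ring (board m m))" and d: "mon_degree u = d"
    using assms(3) u by (auto simp: mpoly_component_def)
  have complete: "Poly_Mapping.single x 1 + u \<in> regular_exponents m m t" if x: "mvar x \<in> P" for x
  proof -
    obtain g v where gv: "g \<in> regular_exponents m m t" "Poly_Mapping.single x 1 + u = g + v"
      using key_completed_by_variable[OF _ u] P x by blast
    have "1 + d = m * t + mon_degree v"
      using arg_cong[OF gv(2), of mon_degree] by (simp add: mon_degree_add d mon_degree_regular_exponent[OF gv(1)])
    then have "mon_degree v = 0" using lt by linarith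
    then show ?thesis using gv by (simp add: mon_degree_eq_0_iff)
  qed
  have unique: "x = y" if x: "mvar x \<in> P" and y: "mvar y \<in> P" for x y
  proof -
    obtain i j k l where ij: "x = (i, j)" "y = (k, l)" by (cases x, cases y)
    have mem: "i \<in> {1..m}" "j \<in> {1..m}" "k \<in> {1..m}" "l \<in> {1..m}"
      using complete[OF x] complete[OF y] by (auto simp: ij regular_exponents_def keys_add_nat board_def)
    have "row_sum m (Poly_Mapping.single x 1 + u) i = t" "row_sum m (Poly_Mapping.single y 1 + u) i = t"
      using complete[OF x] complete[OF y] mem(1) unfolding regular_exponents_def by blast+
    then have "row_sum m u i + 1 = t" "row_sum m u i + of_bool (i = k) = t"
      unfolding ij row_sum_add row_sum_single[OF mem(2)] row_sum_single[OF mem(4)] by simp_all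
    moreover have "col_sum m u j + 1 = t" "col_sum m u j + of_bool (j = l) = t"
      using square_col_sums[OF complete[OF x] mem(2)] square_col_sums[OF complete[OF y] mem(2)]
      unfolding ij col_sum_add col_sum_single[OF mem(1)] col_sum_single[OF mem(3)] by simp_all
    ultimately show ?thesis by (cases "i = k"; cases "j = l") (simp_all add: ij)
  qed
  \<comment> \<open>The identity avoids the squares off the diagonal, the cyclic shift those on it.\<close>
  have avoid: "\<exists>y. mvar y \<in> P \<and> y \<noteq> (i, j)" for i j
  proof -
    have "\<exists>s. inj_on s {1..m} \<and> (\<forall>k\<in>{1..m}. s k \<in> {1..m}) \<and> s i \<noteq> j"
    proof (cases "i = j")
      case True
      have "inj_on (\<lambda>k. if k = m then 1 else Suc k) {1..m}" by (auto simp: inj_on_def split: if_splits)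
      then show ?thesis
        using assms(1) True by (intro exI[of _ "\<lambda>k. if k = m then 1 else Suc k"]) auto
    next
      case False
      then show ?thesis by (intro exI[of _ "\<lambda>k. k"]) auto
    qed
    then obtain s where s: "inj_on s {1..m}" "\<And>k. k \<in> {1..m} \<Longrightarrow> s k \<in> {1..m}" "s i \<noteq> j" by blast
    obtain g where g: "g \<in> regular_exponents m m t"
        "\<And>k l. Poly_Mapping.lookup g (k, l) = (if k \<in> {1..m} \<and> l = s k then t else 0)"
      using matching_exponent[OF s(1,2)] by blast
    then have "Poly_Mapping.keys g \<subseteq> board m m" by (simp add: regular_exponents_def)
    from primeideal_mvar_of_colon[OF assms(2) f P g(1) this]
    obtain y where "y \<in> Poly_Mapping.keys g" "mvar y \<in> P" by blast
    moreover have "(i, j) \<notin> Poly_Mapping.keys g" using s(3) by (simp add: in_keys_iff g(2))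
    ultimately show ?thesis by blast
  qed
  then show False using unique by (metis surj_pair)
qed

section \<open>Upper bounds for the v-number\<close>

text \<open>A multiple \<open>w + u\<close> of a generator has first row sum at least \<open>t\<close>, which forces \<open>u\<close> to involve
the first row. Conversely, every variable of the first row lies in the colon ideal by
assumption.\<close>

lemma v_number_le_of_first_row:
  assumes w: "Poly_Mapping.keys w \<subseteq> board m n" and "1 \<le> m" and row: "row_sum n w 1 < t"
    and div: "\<And>j. j \<in> {1..n} \<Longrightarrow> \<exists>g\<in>regular_exponents m n t. \<exists>v. w + Poly_Mapping.single (1, j) 1 = g + v"
  shows "v_number (board m n)
      (monomial_ideal (board m n) (regular_exponents m n t) :: (nat \<times> nat, 'k::field) mpoly set)
    \<le> enat (mon_degree w)"
proof -
  let ?W = "{1} \<times> {1..n}"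
  have iff: "(\<exists>g\<in>regular_exponents m n t. \<exists>v. w + u = g + v) \<longleftrightarrow>
      (\<exists>x\<in>(\<lambda>x. Poly_Mapping.single x 1) ` ?W. \<exists>v. u = x + v)" (is "?L \<longleftrightarrow> ?R")
    if u: "Poly_Mapping.keys u \<subseteq> board m n" for u
  proof
    assume ?L
    then obtain g v where gv: "g \<in> regular_exponents m n t" "w + u = g + v" by blast
    have "row_sum n w 1 + row_sum n u 1 = row_sum n g 1 + row_sum n v 1"
      using arg_cong[OF gv(2), of "\<lambda>u. row_sum n u 1"] by simp
    then have "row_sum n u 1 \<noteq> 0"
      using gv(1) \<open>1 \<le> m\<close> row by (simp add: regular_exponents_def)
    then obtain j where j: "j \<in> {1..n}" "(1, j) \<in> Poly_Mapping.keys u"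
      unfolding row_sum_def in_keys_iff by (metis sum.neutral)
    then obtain v where "u = Poly_Mapping.single (1, j) 1 + v"
      by (metis exponent_eq_single_add_iff)
    then show ?R using j(1) by blast
  next
    assume ?R
    then obtain j v where j: "j \<in> {1..n}" "u = Poly_Mapping.single (1, j) 1 + v" by blast
    then obtain g v' where g: "g \<in> regular_exponents m n t" "w + Poly_Mapping.single (1, j) 1 = g + v'"
      using div by blast
    have "w + u = g + (v' + v)" unfolding j(2) by (metis g(2) add.assoc)
    then show ?L using g(1) by blast
  qed
  have "ideal_colon (mpoly_ring (board m n)) (monomial_ideal (board m n) (regular_exponents m n t))
      (monomial w :: (nat \<times> nat, 'k) mpoly) =
    monomial_ideal (board m n) ((\<lambda>x. Poly_Mapping.single x 1) ` ?W)"
    unfolding colon_monomial[OF w] unfolding monomial_ideal_def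
    by (rule Collect_cong, rule conj_cong[OF refl], rule ball_cong[OF refl])
       (rule iff, simp add: in_carrier_mpoly_ring_iff)
  moreover have "?W \<subseteq> board m n" using \<open>1 \<le> m\<close> by (auto simp: board_def)
  ultimately show ?thesis by (rule v_number_le_mon_degree[OF w _ primeideal_generated_by_variables])
qed

text \<open>The condition \<open>m t - 1 \<le> n (t - 1)\<close> says that a matrix with row sums \<open>t - 1, t, ..., t\<close> fits
into columns of capacity \<open>t - 1\<close>. Then a unit may be added at any square of the first row
without any column sum exceeding \<open>t\<close>.\<close>

lemma v_number_facet_ideal_power:
  assumes "1 \<le> m" and "m \<le> n" and "1 \<le> t" and room: "m * t - 1 \<le> n * (t - 1)"
  shows "v_number (board m n)
      (monomial_ideal (board m n) (regular_exponents m n t) :: (nat \<times> nat, 'k::field) mpoly set)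
    = enat (m * t - 1)"
proof (rule antisym)
  define r where "r i = (if i = 1 then t - 1 else t)" for i :: nat
  have split: "{1..m} = insert 1 {2..m}" using assms(1) by auto
  have sum_r: "sum r {1..m} = m * t - 1"
  proof -
    have "sum r {1..m} = (t - 1) + (\<Sum>i\<in>{2..m}. t)"
      unfolding split by (subst sum.insert) (auto simp: r_def)
    then show ?thesis using assms(1,3) by (cases m) auto
  qed
  then have "sum r {1..m} \<le> (\<Sum>j\<in>{1..n}. t - 1)" using room by simp
  from transport_le[OF finite_atLeastAtMost finite_atLeastAtMost this]
  obtain a where a: "\<And>i. i \<in> {1..m} \<Longrightarrow> (\<Sum>j\<in>{1..n}. a i j) = r i"
      "\<And>j. j \<in> {1..n} \<Longrightarrow> (\<Sum>i\<in>{1..m}. a i j) \<le> t - 1"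
    by blast
  obtain w where w: "Poly_Mapping.keys w \<subseteq> board m n"
      "\<And>x. x \<in> board m n \<Longrightarrow> Poly_Mapping.lookup w x = a (fst x) (snd x)"
    using exponent_with_entries[OF finite_board, of m n "\<lambda>x. a (fst x) (snd x)"] by blast
  have rows: "row_sum n w i = r i" if "i \<in> {1..m}" for i
    using a(1)[OF that] that by (simp add: row_sum_def w(2) board_def)
  have cols: "col_sum m w j \<le> t - 1" if "j \<in> {1..n}" for j
    using a(2)[OF that] that by (simp add: col_sum_def w(2) board_def)
  have complete: "w + Poly_Mapping.single (1, j) 1 \<in> regular_exponents m n t" if "j \<in> {1..n}" for j
  proof -
    have "row_sum n (w + Poly_Mapping.single (1, j) 1) i = t" if i: "i \<in> {1..m}" for i
      using row_sum_single[OF \<open>j \<in> _\<close>, of 1 i] rows[OF i] assms(3) by (simp add: r_def)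
    moreover have "col_sum m (w + Poly_Mapping.single (1, j) 1) k \<le> t" if k: "k \<in> {1..n}" for k
      using col_sum_single[of 1 m j k] cols[OF k] assms(1,3) by (cases "k = j") simp_all
    ultimately show ?thesis
      using w(1) that assms(1) by (auto simp: regular_exponents_def keys_add_nat board_def)
  qed
  have "v_number (board m n)
      (monomial_ideal (board m n) (regular_exponents m n t) :: (nat \<times> nat, 'k) mpoly set)
    \<le> enat (mon_degree w)"
  proof (rule v_number_le_of_first_row[OF w(1) assms(1)])
    show "row_sum n w 1 < t" using rows[of 1] assms(1,3) by (simp add: r_def)
    show "\<exists>g\<in>regular_exponents m n t. \<exists>v. w + Poly_Mapping.single (1, j) 1 = g + v"
      if "j \<in> {1..n}" for j
      using complete[OF that] by (intro bexI[of _ "w + Poly_Mapping.single (1, j) 1"] exI[of _ 0]) simp_all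
  qed
  also have "mon_degree w = m * t - 1"
    using rows sum_r by (simp add: mon_degree_eq_row_sums[OF w(1)])
  finally show "v_number (board m n)
      (monomial_ideal (board m n) (regular_exponents m n t) :: (nat \<times> nat, 'k) mpoly set)
    \<le> enat (m * t - 1)" .
  show "enat (m * t - 1) \<le> v_number (board m n)
      (monomial_ideal (board m n) (regular_exponents m n t) :: (nat \<times> nat, 'k) mpoly set)"
    by (rule v_number_greatest) (rule mon_degree_lower_bound[OF assms(2)])
qed

text \<open>In the square case the columns of a matrix of degree \<open>m t\<close> cannot all stay below \<open>t\<close>. Instead
the second row is given one unit more than \<open>t\<close> and positive entries throughout: after a unit is
added at \<open>(1, j)\<close>, removing one at \<open>(2, j)\<close> repairs both the second row and column \<open>j\<close>.\<close>

lemma v_number_facet_ideal_power_square: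
  assumes "2 \<le> m" and "m - 1 \<le> t"
  shows "v_number (board m m)
      (monomial_ideal (board m m) (regular_exponents m m t) :: (nat \<times> nat, 'k::field) mpoly set)
    = enat (m * t)"
proof (rule antisym)
  \<comment> \<open>The row sums that remain after a 1 has been reserved for every entry of row 2.\<close>
  define r where "r i = (if i = 1 then t - 1 else if i = 2 then t + 1 - m else t)" for i :: nat
  have t: "1 \<le> t" using assms by linarith
  have split: "{1..m} = insert 1 (insert 2 {3..m})" using assms(1) by auto
  have "sum r {1..m} = (t - 1) + ((t + 1 - m) + (\<Sum>i\<in>{3..m}. t))"
    unfolding split by (simp add: r_def)
  also have "(\<Sum>i\<in>{3..m}. t) = (m - 2) * t" by simp
  also have "(t - 1) + ((t + 1 - m) + (m - 2) * t) + m = m * t"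
  proof -
    obtain k where "m = k + 2" using assms(1) by (metis add.commute le_add_diff_inverse)
    then show ?thesis using assms t by simp
  qed
  finally have sum_r: "sum r {1..m} + m = m * t" .
  then have "sum r {1..m} = (\<Sum>j\<in>{1..m}. t - 1)" using t by (simp add: diff_mult_distrib2)
  from transport_eq[OF finite_atLeastAtMost finite_atLeastAtMost this] obtain a where a: "\<And>i. i \<in> {1..m} \<Longrightarrow> (\<Sum>j\<in>{1..m}. a i j) = r i"
      "\<And>j. j \<in> {1..m} \<Longrightarrow> (\<Sum>i\<in>{1..m}. a i j) = t - 1"
    by blast
  obtain w where w: "Poly_Mapping.keys w \<subseteq> board m m"
      "\<And>x. x \<in> board m m \<Longrightarrow> Poly_Mapping.lookup w x = a (fst x) (snd x) + of_bool (fst x = 2)"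
    using exponent_with_entries[OF finite_board, of m m "\<lambda>x. a (fst x) (snd x) + of_bool (fst x = 2)"]
    by blast
  have rows: "row_sum m w i = r i + (if i = 2 then m else 0)" if "i \<in> {1..m}" for i
    using a(1)[OF that] that by (simp add: row_sum_def w(2) board_def sum.distrib)
  have cols: "col_sum m w j = t" if "j \<in> {1..m}" for j
  proof -
    have "col_sum m w j = (\<Sum>i\<in>{1..m}. a i j) + (\<Sum>i\<in>{1..m}. of_bool (i = 2))"
      using that by (simp add: col_sum_def w(2) board_def sum.distrib)
    then show ?thesis using a(2)[OF that] assms(1) t by simp
  qed
  have swap: "\<exists>g\<in>regular_exponents m m t. \<exists>v. w + Poly_Mapping.single (1, j) 1 = g + v"
    if j: "j \<in> {1..m}" for j
  proof -
    have "(2, j) \<in> Poly_Mapping.keys (w + Poly_Mapping.single (1, j) 1)"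
      using w(2)[of "(2, j)"] j assms(1) by (simp add: in_keys_iff lookup_add board_def)
    then obtain g where g: "w + Poly_Mapping.single (1, j) 1 = Poly_Mapping.single (2, j) 1 + g"
      by (metis exponent_eq_single_add_iff)
    have "Poly_Mapping.keys (w + Poly_Mapping.single (1, j) 1) \<subseteq> board m m"
      using w(1) j assms(1) by (simp add: keys_add_nat board_def)
    then have "Poly_Mapping.keys g \<subseteq> board m m" unfolding g keys_add_nat by simp
    moreover have "row_sum m g i = t" if i: "i \<in> {1..m}" for i
      using arg_cong[OF g, of "\<lambda>u. row_sum m u i"] rows[OF i] t assms
        row_sum_single[OF j, of 1 i] row_sum_single[OF j, of 2 i]
      by (auto simp: r_def split: if_splits)
    moreover have "col_sum m g k \<le> t" if k: "k \<in> {1..m}" for k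
      using arg_cong[OF g, of "\<lambda>u. col_sum m u k"] cols[OF k] assms(1)
        col_sum_single[of 1 m j k] col_sum_single[of 2 m j k]
      by (simp split: if_splits)
    ultimately have "g \<in> regular_exponents m m t" by (simp add: regular_exponents_def)
    then show ?thesis using g by (metis add.commute)
  qed
  have "v_number (board m m)
      (monomial_ideal (board m m) (regular_exponents m m t) :: (nat \<times> nat, 'k) mpoly set)
    \<le> enat (mon_degree w)"
  proof (rule v_number_le_of_first_row[OF w(1) _ _ swap])
    show "1 \<le> m" using assms(1) by simp
    show "row_sum m w 1 < t" using rows[of 1] assms(1) t by (simp add: r_def)
  qed
  also have "mon_degree w = sum r {1..m} + (\<Sum>i\<in>{1..m}. if i = 2 then m else 0)"
    using rows by (simp add: mon_degree_eq_row_sums[OF w(1)] sum.distrib)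
  also have "\<dots> = m * t" using sum_r assms(1) by simp
  finally show "v_number (board m m)
      (monomial_ideal (board m m) (regular_exponents m m t) :: (nat \<times> nat, 'k) mpoly set)
    \<le> enat (m * t)" .
  show "enat (m * t) \<le> v_number (board m m)
      (monomial_ideal (board m m) (regular_exponents m m t) :: (nat \<times> nat, 'k) mpoly set)"
    by (rule v_number_greatest) (rule mon_degree_lower_bound_square[OF assms(1)])
qed

theorem theorem1p6:
  fixes m n t :: nat
    and I :: "(nat \<times> nat, 'k::field) mpoly set"
  assumes "1 \<le> m" and "m \<le> n"
    and "I = facet_ideal (board m n) (chessboard_complex m n)"
  shows "(m = 1 \<and> 1 \<le> t \<longrightarrow>
            v_number (board m n) (ideal_pow (mpoly_ring (board m n)) I t) = enat (t - 1))
       \<and> (2 \<le> m \<and> m < n \<and> n \<le> 2 * m - 2 \<and> m \<le> t \<longrightarrow>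
            v_number (board m n) (ideal_pow (mpoly_ring (board m n)) I t) = enat (m * t - 1))
       \<and> (2 * m - 1 \<le> n \<and> 2 \<le> t \<longrightarrow>
            v_number (board m n) (ideal_pow (mpoly_ring (board m n)) I t) = enat (m * t - 1))
       \<and> (n = m \<and> 2 \<le> m \<and> m - 1 \<le> t \<longrightarrow>
            v_number (board m n) (ideal_pow (mpoly_ring (board m n)) I t) = enat (m * t))"
proof -
  have pow: "ideal_pow (mpoly_ring (board m n)) I t =
      monomial_ideal (board m n) (regular_exponents m n t)"
    unfolding assms(3) by (rule ideal_pow_facet_ideal[OF assms(2)])
  have room1: "m * t - 1 \<le> n * (t - 1)" if "m = 1" "1 \<le> t"
    using that assms(2) by simp
  \<comment> \<open>For \<open>t \<ge> m\<close> the difference of the two sides is at least \<open>(m - 1) (n - m - 1)\<close>.\<close>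
  have room2: "m * t - 1 \<le> n * (t - 1)" if nm: "m < n" "m \<le> t"
  proof -
    obtain e s where e: "n = m + 1 + e" and s: "t = m + s"
      using nm by (metis Suc_eq_plus1 add.commute le_add_diff_inverse less_eq_Suc_le)
    obtain k where k: "m = Suc k" using assms(1) by (cases m) auto
    show ?thesis unfolding e s k by (simp add: algebra_simps)
  qed
  \<comment> \<open>For \<open>n = 2 m - 1\<close> the difference of the two sides is \<open>(m - 1) (t - 2)\<close>.\<close>
  have room3: "m * t - 1 \<le> n * (t - 1)" if nm: "2 * m - 1 \<le> n" "2 \<le> t"
  proof -
    obtain k where k: "m = Suc k" using assms(1) by (cases m) auto
    obtain s where s: "t = s + 2" using nm(2) by (metis add.commute le_add_diff_inverse)
    have "m * t - 1 \<le> (2 * m - 1) * (t - 1)" unfolding k s by (simp add: algebra_simps)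
    also have "\<dots> \<le> n * (t - 1)" using nm(1) by (rule mult_right_mono) simp
    finally show ?thesis .
  qed
  note v = v_number_facet_ideal_power[OF assms(1,2), of t, where 'k = 'k]
  show ?thesis
    unfolding pow using v room1 room2 room3 v_number_facet_ideal_power_square[of m t, where 'k = 'k]
      assms(1) by auto
qed

end
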